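(* Let $p$ be a prime, let $t \geq 1$ be an integer, and let $n = m p^r$ be a positive integer with $m \ge 1$, $r \geq 0$ and $p \nmid m$. (i) The order of $\mathrm{RC}_n(\mathbb{F}_{p^t})$ is $$\prod_{d \mid m} \left( (p^{t\cdot \mathrm{ord}_d(p^t)} - 1)^{\phi(d)/\mathrm{ord}_d(p^t)} \cdot p^{t (p^r - 1) \phi(d)} \right),$$ where $d$ runs over the positive divisors of $m$. (ii) Let $\mathbb{F}_{p^s} \geq \mathbb{F}_{p^t}$ be a field extension such that $\mathbb{F}_{p^s}$ contains the $m$-th roots of unity. Write the permutation $\sigma : \mathbb{Z}/m\mathbb{Z} \rightarrow \mathbb{Z}/m\mathbb{Z}$, $x \mapsto p^{-t}x$ as $\sigma = \sigma_1 \cdots \sigma_l$ with disjoint cycles $\sigma_k = (s_{k,1},\dots,s_{k,m_k})$ of length $m_k$. Then, as a subgroup of $\mathrm{GL}_n(\mathbb{F}_{p^s})$, the group $\mathrm{RC}_n(\mathbb{F}_{p^t})$ is conjugate to the group consisting of the block diagonal matrices $$\begin{pmatrix} T(v_{(1)}) & & \\ & \ddots & \\ & & T(v_{(m)}) \end{pmatrix}$$ with vectors $v_{(i)} = (v_{i,j})_{1 \le j \le p^r} \in \mathbb{F}_{p^s}^{p^r}$, $1 \le i \le m$, satisfying $$v_{1,p^r},\, v_{2,p^r},\, \dots,\, v_{m,p^r} \neq 0$$ and $$v_{(s_{k,1})} \in \mathbb{F}_{p^{t m_k}}^{p^r}, \qquad v_{(s_{k,i})} = F^{(i-1)t}(v_{(s_{k,1})})$$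 for $2 \leq i \leq m_k$, $1 \leq k \leq l$.
   Context: A matrix $(a_{i,j})_{1 \leq i,j \leq n}$ is called circulant if $a_{i,j+1} = a_{i-1,j}$ for all $1 \leq i,j \leq n$, where indices are read modulo $n$. For a commutative ring $R$, $\mathrm{RC}_n(R)$ denotes the group (under matrix multiplication) of regular, i.e. invertible over $R$, circulant $(n\times n)$-matrices over $R$. For positive integers $d,k$ with $\gcd(d,k)=1$, $\mathrm{ord}_d(k)$ is the order of $k$ in the multiplicative group $(\mathbb{Z}/d\mathbb{Z})^*$ (so $\mathrm{ord}_1(k)=1$). $\phi$ is the Euler function. For an integer $u\ge 0$, $F^{u}$ denotes the map $x \mapsto x^{p^{u}}$ on $\mathbb{F}_{p^s}$, applied componentwise to vectors. For a vector $w = (w_1,\dots,w_k) \in \mathbb{F}_{p^s}^k$, $T(w)$ is the upper triangular $(k\times k)$-matrix $T(w) := (w_{k-j+i})_{1\leq i,j\leq k}$, where $w_\lambda := 0$ for $\lambda > k$ (so all diagonal entries equal $w_k$, the first superdiagonal entries equal $w_{k-1}$, etc.). The elements of $\mathbb{Z}/m\mathbb{Z}$ are identified with $1,\dots,m$ for indexing. In the decomposition of $\sigma$ into disjoint cycles, fixed points are included as cycles of length $1$ (so every element of $\mathbb{Z}/m\mathbb{Z}$ occurs in exactly one cycle), and $\sigma_k$ maps $s_{k,i}$ to $s_{k,i+1}$ (with $s_{k,m_k+1} = s_{k,1}$). For each $k$, $\mathbb{F}_{p^{t m_k}}$ is regarded as a subfield of $\mathbb{F}_{p^s}$. *)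

theory Defs
  imports
    "HOL-Algebra.Algebraic_Closure_Type"
    "HOL-Algebra.Coset"
    "HOL-Combinatorics.Cycles"
    "HOL-Number_Theory.Number_Theory"
    "Jordan_Normal_Form.Matrix"
begin

definition GL :: "nat \<Rightarrow> 'a::comm_ring_1 mat monoid" where
  "GL n = units_of (ring_mat TYPE('a) n ())"

(* Matrix indices run over 0..n-1 here; (i + n - 1) mod n is i - 1 read modulo n. *)
definition circulant :: "nat \<Rightarrow> 'a mat \<Rightarrow> bool" where
  "circulant n A \<longleftrightarrow> A \<in> carrier_mat n n \<and>
     (\<forall>i<n. \<forall>j<n. A $$ (i, (j + 1) mod n) = A $$ ((i + n - 1) mod n, j))"

(* Regular means invertible over the ring; the inverse is not required to be circulant. *)
definition RC :: "nat \<Rightarrow> 'a::comm_ring_1 mat monoid" where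
  "RC n = (GL n)\<lparr>carrier := {A \<in> carrier (GL n). circulant n A}\<rparr>"

definition conjugate_subgroups :: "('a, 'b) monoid_scheme \<Rightarrow> 'a set \<Rightarrow> 'a set \<Rightarrow> bool" where
  "conjugate_subgroups G H K \<longleftrightarrow> subgroup H G \<and> subgroup K G \<and>
     (\<exists>g\<in>carrier G. K = g <#\<^bsub>G\<^esub> (H #>\<^bsub>G\<^esub> inv\<^bsub>G\<^esub> g))"

(* The m-th roots of unity are those of an algebraic closure. *)
definition contains_roots_of_unity :: "'a::field itself \<Rightarrow> nat \<Rightarrow> bool" where
  "contains_roots_of_unity _ m \<longleftrightarrow>
     {z :: 'a alg_closure. z ^ m = 1} \<subseteq> range (to_ac :: 'a \<Rightarrow> 'a alg_closure)"

(* Meaningful when 'a is finite and has a subfield with q elements, which is then unique. *)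
definition subfield_of_order :: "nat \<Rightarrow> 'a::field set" where
  "subfield_of_order q = (THE L. subfield L (ring_of_type_algebra :: 'a ring) \<and> card L = q)"

definition frob :: "nat \<Rightarrow> nat \<Rightarrow> 'a::field vec \<Rightarrow> 'a vec" where
  "frob p u w = map_vec (\<lambda>x. x ^ (p ^ u)) w"

(* The 1-based coordinate w_l of w, which is 0 for l > dim_vec w. *)
definition coord :: "'a::zero vec \<Rightarrow> nat \<Rightarrow> 'a" where
  "coord w l = (if l > dim_vec w then 0 else w $ (l - 1))"

(* Only the difference i - j enters the index k - j + i, so it is the same for 0-based i, j;
   the natural-number subtraction is exact because j < k. *)
definition T_mat :: "'a::zero vec \<Rightarrow> 'a mat" where
  "T_mat w = (let k = dim_vec w in mat k k (\<lambda>(i, j). coord w (k - j + i)))"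

(* Elements of Z/mZ are represented by 1, ..., m. *)
definition residue_rep :: "nat \<Rightarrow> int \<Rightarrow> nat" where
  "residue_rep m z = (if z mod int m = 0 then m else nat (z mod int m))"

(* The map x |-> p^(-t) x of Z/mZ, extended by the identity outside {1..m}. *)
definition sigma :: "nat \<Rightarrow> nat \<Rightarrow> nat \<Rightarrow> nat \<Rightarrow> nat" where
  "sigma p t m x = (if x \<in> {1..m}
     then residue_rep m (modular_inverse (int m) (int p ^ t) * int x) else x)"

(* cycle_of_list [s_1, ..., s_k] maps s_i to s_(i+1) and s_k to s_1; fixed points in A are
   listed as cycles of length 1. *)
definition cycle_decomposition :: "nat set \<Rightarrow> (nat \<Rightarrow> nat) \<Rightarrow> nat list list \<Rightarrow> bool" where
  "cycle_decomposition A f cs \<longleftrightarrow>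
     [] \<notin> set cs \<and> distinct (concat cs) \<and> set (concat cs) = A \<and>
     f = foldr (\<circ>) (map cycle_of_list cs) id"

(* The cycle c = (s_(k,1), ..., s_(k,m_k)) has c ! i = s_(k,i+1), so the exponent (i-1)t of
   the Frobenius map becomes i * t. *)
definition block_matrices ::
  "nat \<Rightarrow> nat \<Rightarrow> nat \<Rightarrow> nat \<Rightarrow> nat list list \<Rightarrow> 'a::field mat set" where
  "block_matrices p t m r cs =
     {diag_block_mat (map (\<lambda>i. T_mat (v i)) [1..<Suc m]) | v :: nat \<Rightarrow> 'a vec.
        (\<forall>i\<in>{1..m}. v i \<in> carrier_vec (p ^ r) \<and> coord (v i) (p ^ r) \<noteq> 0) \<and>
        (\<forall>c\<in>set cs.
           set\<^sub>v (v (c ! 0)) \<subseteq> subfield_of_order (p ^ (t * length c)) \<and>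
           (\<forall>i\<in>{1..<length c}. v (c ! i) = frob p (i * t) (v (c ! 0))))}"

end

theory Submission
  imports Defs "Jordan_Normal_Form.Char_Poly" "HOL-Algebra.Group_Action"
begin

text \<open>
  Circulant matrices are the elements of \<open>F[x]/(x^n - 1)\<close>, and \<open>x^n - 1 = (x^m - 1)^(p^r)\<close> in
  characteristic \<open>p\<close>. Over a field with all \<open>m\<close>-th roots of unity, expanding a polynomial at each
  such root \<open>z\<close> to order \<open>p^r\<close> is therefore a linear isomorphism; it turns multiplication by \<open>f\<close>
  into a block diagonal matrix whose blocks are the triangular Toeplitz matrices of the Taylor
  coefficients of \<open>f\<close>, and \<open>f\<close> is invertible iff it vanishes at no root. With \<open>q = p^t\<close>,
  the coefficients of \<open>f\<close> lie in the field of \<open>q\<close> elements iff the Taylor coefficients at \<open>z^q\<close>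
  are the \<open>q\<close>-th powers of those at \<open>z\<close>, which is (ii). Such a family is determined freely by its
  members at one root per cycle of length \<open>L\<close>, with entries satisfying \<open>x^(q^L) = x\<close>. Counting
  these families over the algebraic closure, where no extension degree has to be chosen, gives (i).
\<close>

text \<open>Let \<open>N = p^r\<close> and \<open>q = p^t\<close>. The shape of \<open>T_mat\<close>
  dictates the basis \<open>(x - z)^(N-1), ..., 1\<close> of the quotient by
  \<open>(x - z)^N\<close>: only in this order does the constant Taylor coefficient reach the
  diagonal. The Frobenius rule holds because \<open>x \<mapsto> x^q\<close> is a field homomorphism:
  it carries the expansion of \<open>f\<close> at \<open>z\<close> to the expansion at
  \<open>z^q\<close> of the polynomial with \<open>q\<close>-th power coefficients, and expansions
  at all roots determine a polynomial of degree below \<open>n\<close>. The delicate point is the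
  indexing: with \<open>Z x = w^x\<close> for a primitive root \<open>w\<close>, Frobenius would act
  as the inverse of \<open>sigma\<close>, so another labelling has to be found. The exponents in (i)
  are arithmetic: the cycle through \<open>x\<close> has length \<open>ord_d(q)\<close> for
  \<open>d = m / gcd(x, m)\<close>, so \<open>phi(d) / ord_d(q)\<close> cycles belong to
  \<open>d\<close>. In (ii) the subfields that are named exist because a primitive
  \<open>m\<close>-th root of unity in the field forces \<open>t\<close> times each cycle length to
  divide \<open>s\<close>.\<close>

unbundle no fps_syntax

declare upt_Suc [simp del]

section \<open>Roots of unity and Frobenius fixed points\<close>

text \<open>Writing \<open>p = q * r\<close>, the \<open>degree p\<close> roots are shared between
  \<open>q\<close> and \<open>r\<close>, neither of which has more roots than its degree, so both
  bounds are attained.\<close>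

lemma card_roots_dvd:
  fixes p q :: "'a::idom poly"
  assumes "p \<noteq> 0" "q dvd p" "card {x. poly p x = 0} = degree p"
  shows "card {x. poly q x = 0} = degree q"
proof -
  obtain r where r: "p = q * r" using assms(2) by (elim dvdE)
  have nz: "q \<noteq> 0" "r \<noteq> 0" using assms(1) r by auto
  have "{x. poly p x = 0} = {x. poly q x = 0} \<union> {x. poly r x = 0}"
    by (auto simp: r)
  then have "degree p \<le> card {x. poly q x = 0} + card {x. poly r x = 0}"
    using assms(3) card_Un_le by metis
  moreover have "degree p = degree q + degree r" using nz r by (simp add: degree_mult_eq)
  moreover have "card {x. poly r x = 0} \<le> degree r" "card {x. poly q x = 0} \<le> degree q"
    using nz by (auto intro: card_poly_roots_bound)
  ultimately show ?thesis by linarith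
qed

lemma degree_monom_minus_less:
  fixes q :: "'a::comm_ring_1 poly"
  assumes "degree q < k"
  shows "degree (monom 1 k - q) = k" and "monom 1 k - q \<noteq> 0"
proof -
  show *: "degree (monom 1 k - q) = k"
    using degree_add_eq_left[of "-q" "monom 1 k"] assms by (simp add: degree_monom_eq)
  show "monom 1 k - q \<noteq> 0" using * assms by auto
qed

lemma card_roots_of_unity_dvd:
  fixes m d :: nat
  assumes "m > 0" "d dvd m" "card {z::'a::idom. z ^ m = 1} = m"
  shows "card {z::'a. z ^ d = 1} = d"
proof -
  have d: "d > 0" using assms by (auto intro: Nat.gr0I)
  obtain k where k: "m = d * k" using assms(2) by auto
  have eq: "{z. poly (monom 1 j - 1) z = 0} = {z::'a. z ^ j = 1}" for j
    by (auto simp: poly_monom)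
  have "(monom 1 d :: 'a poly) - 1 dvd monom 1 d ^ k - 1"
    by (metis dvd_triv_left power_diff_1_eq)
  then have dv: "(monom 1 d :: 'a poly) - 1 dvd monom 1 m - 1"
    by (simp add: monom_power k mult.commute)
  show ?thesis
    using card_roots_dvd[OF _ dv] assms d degree_monom_minus_less[of "1::'a poly" m]
      degree_monom_minus_less[of "1::'a poly" d] unfolding eq by simp
qed

lemma power_eq_1_gcd:
  fixes z :: "'a::field"
  assumes "z ^ a = 1" "z ^ b = 1"
  shows "z ^ gcd a b = 1"
  using assms
proof (induction a b rule: gcd_nat_induct)
  case (step m n)
  have "z ^ m = (z ^ n) ^ (m div n) * z ^ (m mod n)"
    by (metis div_mult_mod_eq mult.commute power_add power_mult)
  with step show ?case by (simp add: gcd_red_nat[of m n])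
qed simp

text \<open>Argues from the number of roots alone, so it serves finite fields and algebraic closures
  alike. For a prime power \<open>l ^ a\<close> dividing \<open>m\<close> there are more
  \<open>l ^ a\<close>-th than \<open>l ^ (a - 1)\<close>-th roots of unity, hence an element of
  exact order \<open>l ^ a\<close>; elements of coprime orders are then multiplied.\<close>

lemma exists_primitive_root_of_unity:
  fixes m :: nat
  assumes "m > 0" and c: "card {z::'a::field. z ^ m = 1} = m"
  shows "\<exists>w::'a. \<forall>e. w ^ e = 1 \<longleftrightarrow> m dvd e"
proof -
  have pp: "\<exists>z::'a. z ^ (l ^ a) = 1 \<and> (\<forall>e. z ^ e = 1 \<longrightarrow> l ^ a dvd e)"
    if l: "Factorial_Ring.prime l" "a > 0" and dv: "l ^ a dvd m" for l a :: nat
  proof -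
    have c1: "card {z::'a. z ^ (l ^ a) = 1} = l ^ a"
      by (rule card_roots_of_unity_dvd[OF assms(1) dv c])
    have c2: "card {z::'a. z ^ (l ^ (a - 1)) = 1} = l ^ (a - 1)"
      by (rule card_roots_of_unity_dvd[OF assms(1) _ c])
        (use dv in \<open>meson dvd_trans le_imp_power_dvd diff_le_self\<close>)
    have lt: "l ^ (a - 1) < l ^ a"
      using l by (intro power_strict_increasing) (auto dest: prime_gt_1_nat)
    have "\<not> {z::'a. z ^ (l ^ a) = 1} \<subseteq> {z. z ^ (l ^ (a - 1)) = 1}"
    proof
      assume "{z::'a. z ^ (l ^ a) = 1} \<subseteq> {z. z ^ (l ^ (a - 1)) = 1}"
      moreover have "finite {z::'a. z ^ (l ^ (a - 1)) = 1}"
        using c2 l by (intro card_ge_0_finite) (simp add: prime_gt_0_nat)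
      ultimately have "l ^ a \<le> l ^ (a - 1)" using card_mono c1 c2 by metis
      then show False using lt by simp
    qed
    then obtain z :: 'a where z: "z ^ (l ^ a) = 1" "z ^ (l ^ (a - 1)) \<noteq> 1" by blast
    have "l ^ a dvd e" if e: "z ^ e = 1" for e
    proof -
      have g: "z ^ gcd e (l ^ a) = 1" using e z by (intro power_eq_1_gcd)
      obtain b where b: "b \<le> a" "gcd e (l ^ a) = l ^ b"
        using divides_primepow_nat[OF l(1)] gcd_dvd2 by blast
      have "b = a"
      proof (rule ccontr)
        assume "b \<noteq> a"
        then have "l ^ b dvd l ^ (a - 1)" using b by (intro le_imp_power_dvd) auto
        then have "z ^ (l ^ (a - 1)) = 1" using g b by (auto simp: power_mult elim!: dvdE)
        then show False using z by simp
      qed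
      then show ?thesis using b gcd_dvd1 by metis
    qed
    then show ?thesis using z by blast
  qed
  have "d > 0 \<Longrightarrow> d dvd m \<Longrightarrow> \<exists>z::'a. z ^ d = 1 \<and> (\<forall>e. z ^ e = 1 \<longrightarrow> d dvd e)" for d
  proof (induction d rule: less_induct)
    case (less d)
    show ?case
    proof (cases "d = 1")
      case True then show ?thesis by (intro exI[of _ 1]) auto
    next
      case False
      then obtain l where l: "Factorial_Ring.prime l" "l dvd d" using prime_factor_nat by blast
      define a where "a = multiplicity l d"
      obtain d' where d': "d = l ^ a * d'" "\<not> l dvd d'"
        using multiplicity_decompose'[of d l] less.prems l unfolding a_def
        by (metis not_prime_unit gr_implies_not0)
      have a: "a > 0" using d' l by (metis gr0I mult_1 power_0)
      have d'0: "d' > 0" using d' less.prems by (auto intro: Nat.gr0I)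
      have "d' < d" using d' a d'0 prime_gt_1_nat[OF l(1)] one_less_power[of l a] by simp
      moreover have "d' dvd m" "l ^ a dvd m" using d' less.prems by (auto intro: dvd_trans)
      ultimately obtain y z :: 'a where
        y: "y ^ d' = 1" "\<And>e. y ^ e = 1 \<Longrightarrow> d' dvd e" and
        z: "z ^ (l ^ a) = 1" "\<And>e. z ^ e = 1 \<Longrightarrow> l ^ a dvd e"
        using less.IH[of d'] pp[OF l(1) a] d'0 by blast
      have cop: "coprime (l ^ a) d'" using d' l prime_imp_coprime_nat by simp
      have "d dvd e" if e: "(y * z) ^ e = 1" for e
      proof -
        \<comment> \<open>The power \<open>l ^ a\<close> removes \<open>z\<close> and isolates
          \<open>y\<close>; the power \<open>d'\<close> below isolates \<open>z\<close>.\<close>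
        have "1 = ((y * z) ^ e) ^ (l ^ a)" using e by simp
        also have "\<dots> = y ^ (e * l ^ a) * (z ^ (l ^ a)) ^ e"
          by (simp add: power_mult_distrib power_mult[symmetric] mult.commute)
        finally have "d' dvd e * l ^ a" using y z by simp
        then have 1: "d' dvd e" using cop by (simp add: coprime_commute coprime_dvd_mult_left_iff)
        have "1 = ((y * z) ^ e) ^ d'" using e by simp
        also have "\<dots> = (y ^ d') ^ e * z ^ (e * d')"
          by (simp add: power_mult_distrib power_mult[symmetric] mult.commute)
        finally have "l ^ a dvd e * d'" using y z by simp
        then have 2: "l ^ a dvd e" using cop by (simp add: coprime_dvd_mult_left_iff)
        show ?thesis unfolding d' using 1 2 cop by (rule_tac divides_mult) auto
      qed
      moreover have "(y * z) ^ d = (z ^ (l ^ a)) ^ d' * (y ^ d') ^ (l ^ a)"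
        by (simp add: d' power_mult_distrib power_mult[symmetric] mult.commute)
      then have "(y * z) ^ d = 1" using y z by simp
      ultimately show ?thesis by blast
    qed
  qed
  from this[of m] obtain w :: 'a where w: "w ^ m = 1" "\<And>e. w ^ e = 1 \<Longrightarrow> m dvd e"
    using assms(1) by auto
  then have "w ^ e = 1 \<longleftrightarrow> m dvd e" for e by (auto simp: power_mult elim!: dvdE)
  then show ?thesis by blast
qed

section \<open>Characteristic, and the number of solutions of \<open>z^m = 1\<close> and
  \<open>x^Q = x\<close>\<close>

lemma CHAR_eq_if_card_UNIV:
  assumes "Factorial_Ring.prime p" "card (UNIV :: 'a::field set) = p ^ s"
  shows "CHAR('a) = p"
proof -
  have "CHAR('a) dvd p ^ s" using CHAR_dvd_CARD[where 'a='a] assms(2) by simp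
  moreover have "CHAR('a) > 0" using dvd_pos_nat[OF _ calculation] assms(1) prime_gt_0_nat by simp
  then have "Factorial_Ring.prime CHAR('a)" using prime_CHAR_semidom by blast
  ultimately show ?thesis using assms(1) prime_dvd_power primes_dvd_imp_eq by blast
qed

text \<open>Multiplication by a nonzero \<open>x\<close> permutes the nonzero elements of
  \<open>L\<close>, so their product absorbs the factor \<open>x ^ (card L - 1)\<close>. Phrased for
  a subset in order to cover whole fields and subfields.\<close>

lemma power_card_eq_self:
  fixes L :: "'a::field set"
  assumes "finite L" "0 \<in> L" "\<And>x y. x \<in> L \<Longrightarrow> y \<in> L \<Longrightarrow> x * y \<in> L" "x \<in> L"
  shows "x ^ card L = x"
proof (cases "x = 0")
  case True
  then show ?thesis using assms card_gt_0_iff[of L] by (auto simp: power_0_left)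
next
  case False
  let ?U = "L - {0}"
  have inj: "inj_on ((*) x) ?U" using False by (auto intro: inj_onI)
  have "(*) x ` ?U \<subseteq> ?U" using assms False by auto
  then have im: "(*) x ` ?U = ?U"
    using assms(1) inj by (simp add: card_image card_subset_eq)
  have "prod id ?U = (\<Prod>y\<in>?U. x * y)"
    using prod.reindex[OF inj, of id] im by (simp add: o_def)
  also have "\<dots> = x ^ card ?U * prod id ?U" by (simp add: prod.distrib)
  finally have "x ^ card ?U = 1" using assms(1) by (simp add: prod_zero_iff)
  moreover have "card L = Suc (card ?U)" using assms card_gt_0_iff[of L] by auto
  ultimately show ?thesis by simp
qed

lemma rsquarefree_if_coprime_pderiv:
  fixes f :: "'a::field poly"
  assumes "f \<noteq> 0" "\<And>a. poly f a = 0 \<Longrightarrow> poly (pderiv f) a \<noteq> 0"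
  shows "rsquarefree f"
proof -
  have "order a f < 2" for a
  proof (rule ccontr)
    assume "\<not> order a f < 2"
    then have "[:- a, 1:] ^ 2 dvd f" by (meson le_imp_power_dvd dvd_trans order_1 not_less)
    then obtain g where "f = [:- a, 1:] ^ 2 * g" by (elim dvdE)
    then have g: "f = [:- a, 1:] * ([:- a, 1:] * g)" by (simp only: power2_eq_square mult.assoc)
    have "poly f a = 0" by (simp add: g)
    moreover have "poly (pderiv f) a = 0" unfolding g pderiv_mult by (simp add: pderiv_pCons)
    ultimately show False using assms(2) by blast
  qed
  then show ?thesis using assms(1) less_2_cases unfolding rsquarefree_def by (metis One_nat_def)
qed

lemma card_roots_alg_closed:
  fixes f :: "'a::alg_closed_field poly"
  assumes "rsquarefree f"
  shows "card {x. poly f x = 0} = degree f"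
proof -
  have nz: "f \<noteq> 0" using assms by (simp add: rsquarefree_def)
  obtain A where A: "size A = degree f" "f = smult (lead_coeff f) (\<Prod>x\<in>#A. [:- x, 1:])"
    using alg_closed_imp_factorization[OF nz] by blast
  have "proots (\<Prod>x\<in>#A. [:- x, 1:]) = A"
  proof (induction A)
    case (add y A)
    have "(\<Prod>x\<in>#A. [:- x, 1:]) \<noteq> 0" by (auto simp: prod_mset_zero_iff)
    then show ?case using add proots_mult[of "[:- y, 1:]"] by simp
  qed simp
  then have "proots f = A" by (subst A(2)) (use nz in simp)
  then have "count A x = order x f" for x using nz count_proots by metis
  then have "mset_set {x. poly f x = 0} = A"
    using assms nz poly_roots_finite[OF nz]
    by (intro multiset_eqI) (auto simp: count_mset_set' rsquarefree_def order_root, metis neq0_conv)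
  then show ?thesis using A(1) size_mset_set by metis
qed

text \<open>The derivative \<open>m z^(m-1)\<close> vanishes at most at 0, which is no root of
  \<open>z^m - 1\<close>.\<close>

lemma card_roots_of_unity_alg_closed:
  assumes "of_nat m \<noteq> (0::'a::alg_closed_field)"
  shows "card {z::'a. z ^ m = 1} = m"
proof -
  have m: "m > 0" using assms by (auto intro: Nat.gr0I)
  have "rsquarefree (monom 1 m - 1 :: 'a poly)"
    using assms m degree_monom_minus_less(2)[of "1::'a poly" m]
    by (intro rsquarefree_if_coprime_pderiv)
      (auto simp: poly_monom pderiv_diff pderiv_monom power_0_left)
  from card_roots_alg_closed[OF this] show ?thesis
    using degree_monom_minus_less(1)[of "1::'a poly" m] m by (simp add: poly_monom)
qed

text \<open>As \<open>Q\<close> is 0 in the field, the derivative of \<open>x^Q - x\<close> is the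
  constant -1.\<close>

lemma card_frobenius_fixed_alg_closed:
  assumes "of_nat Q = (0::'a::alg_closed_field)" "Q > 1"
  shows "card {x::'a. x ^ Q = x} = Q"
proof -
  have "rsquarefree (monom 1 Q - monom 1 1 :: 'a poly)"
    using assms degree_monom_minus_less(2)[of "monom 1 1::'a poly" Q]
    by (intro rsquarefree_if_coprime_pderiv) (auto simp: poly_monom pderiv_diff pderiv_monom degree_monom_eq)
  from card_roots_alg_closed[OF this] show ?thesis
    using degree_monom_minus_less(1)[of "monom 1 1::'a poly" Q] assms
    by (simp add: poly_monom degree_monom_eq)
qed

lemma card_frobenius_fixed_le:
  assumes "Q > 1"
  shows "finite {x::'a::idom. x ^ Q = x}" "card {x::'a. x ^ Q = x} \<le> Q"
proof -
  let ?f = "monom 1 Q - monom 1 1 :: 'a poly"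
  have f: "degree ?f = Q" "?f \<noteq> 0"
    using degree_monom_minus_less[of "monom 1 1::'a poly" Q] assms by (auto simp: degree_monom_eq)
  have eq: "{x::'a. x ^ Q = x} = {x. poly ?f x = 0}" by (auto simp: poly_monom)
  show "finite {x::'a. x ^ Q = x}" "card {x::'a. x ^ Q = x} \<le> Q"
    unfolding eq using poly_roots_finite[OF f(2)] card_poly_roots_bound[OF f(2)] f(1) by auto
qed

section \<open>Taylor coefficients of polynomials\<close>

text \<open>The coefficient of \<open>(x - z)^e\<close> in \<open>f\<close>, that is the
  \<open>e\<close>-th Hasse derivative at \<open>z\<close>. Substituting \<open>x + z\<close> avoids
  a division by \<open>e!\<close>, which may be 0 in characteristic \<open>p\<close>.\<close>

definition taylor_coeff :: "'a::comm_ring_1 \<Rightarrow> 'a poly \<Rightarrow> nat \<Rightarrow> 'a" where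
  "taylor_coeff z f e = coeff (pcompose f [:z, 1:]) e"

lemma pcompose_power: "pcompose (f ^ k) g = pcompose f g ^ k"
  by (induction k) (simp_all add: pcompose_mult pcompose_1)

lemma taylor_coeff_0_right: "taylor_coeff z f 0 = poly f z"
  by (simp add: taylor_coeff_def coeff_pcompose_0)

lemma taylor_coeff_diff: "taylor_coeff z (f - g) e = taylor_coeff z f e - taylor_coeff z g e"
  by (simp add: taylor_coeff_def pcompose_diff)

lemma taylor_coeff_sum: "taylor_coeff z (sum f A) e = (\<Sum>i\<in>A. taylor_coeff z (f i) e)"
  by (simp add: taylor_coeff_def pcompose_sum coeff_sum)

lemma taylor_coeff_monom: "taylor_coeff z (monom c l) e = c * taylor_coeff z (monom 1 l) e"
proof -
  have "monom c l = smult c (monom 1 l)" by (simp add: smult_monom)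
  then show ?thesis by (simp only: taylor_coeff_def pcompose_smult coeff_smult)
qed

lemma taylor_coeff_mult:
  "taylor_coeff z (f * g) e = (\<Sum>i\<le>e. taylor_coeff z f i * taylor_coeff z g (e - i))"
  by (simp add: taylor_coeff_def pcompose_mult coeff_mult)

text \<open>Substituting \<open>x + z\<close> for \<open>x\<close> is an automorphism of the
  polynomial ring that sends \<open>(x - z)^N\<close> to \<open>x^N\<close>.\<close>

lemma taylor_coeff_eq_0_iff:
  fixes f :: "'a::field poly"
  shows "(\<forall>e<N. taylor_coeff z f e = 0) \<longleftrightarrow> [:- z, 1:] ^ N dvd f"
proof
  assume *: "\<forall>e<N. taylor_coeff z f e = 0"
  then have "monom 1 N dvd pcompose f [:z, 1:]"
    by (simp add: monom_1_dvd_iff' taylor_coeff_def)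
  then obtain h where h: "pcompose f [:z, 1:] = monom 1 N * h" by (elim dvdE)
  have "f = pcompose (pcompose f [:z, 1:]) [:- z, 1:]"
    by (simp add: pcompose_pCons flip: pcompose_assoc)
  also have "\<dots> = [:- z, 1:] ^ N * pcompose h [:- z, 1:]"
    by (simp add: h pcompose_mult monom_altdef pcompose_power pcompose_pCons)
  finally show "[:- z, 1:] ^ N dvd f" by (metis dvd_triv_left)
next
  assume "[:- z, 1:] ^ N dvd f"
  then obtain h where "f = [:- z, 1:] ^ N * h" by (elim dvdE)
  then have "pcompose f [:z, 1:] = monom 1 N * pcompose h [:z, 1:]"
    by (simp add: pcompose_mult monom_altdef pcompose_power pcompose_pCons)
  then show "\<forall>e<N. taylor_coeff z f e = 0"
    by (simp add: taylor_coeff_def coeff_monom_mult)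
qed

text \<open>Counted with multiplicity, \<open>A\<close> would supply \<open>N * card A\<close>
  roots, more than the degree. This is the injectivity of Taylor expansion to order
  \<open>N\<close>.\<close>

lemma eq_0_if_linear_powers_dvd:
  fixes f :: "'a::field poly"
  assumes "finite A" "\<And>a. a \<in> A \<Longrightarrow> [:- a, 1:] ^ N dvd f" "degree f < N * card A"
  shows "f = 0"
proof (rule ccontr)
  assume nz: "f \<noteq> 0"
  have "repeat_mset N (mset_set A) \<subseteq># proots f"
    using assms(1,2) nz order_divides[of _ N f] by (intro mset_subset_eqI) (auto simp: count_mset_set')
  from size_mset_mono[OF this] have "N * card A \<le> size (proots f)" by simp
  with size_proots_le[of f] assms(3) show False by simp
qed

lemma monom_mod_dvd:
  "monom 1 n - 1 dvd monom c s - (monom c (s mod n) :: 'a::comm_ring_1 poly)"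
proof -
  have "(monom 1 n :: 'a poly) - 1 dvd monom 1 n ^ (s div n) - 1"
    by (metis dvd_triv_left power_diff_1_eq)
  then have "(monom 1 n :: 'a poly) - 1 dvd monom c (s mod n) * (monom 1 n ^ (s div n) - 1)"
    by (rule dvd_mult)
  also have "monom c (s mod n) * (monom 1 n ^ (s div n) - 1) = monom c s - monom c (s mod n)"
    by (simp add: algebra_simps monom_power mult_monom)
  finally show ?thesis .
qed

section \<open>Circulant matrices\<close>

text \<open>For \<open>degree f < n\<close>, column \<open>j\<close> holds the coefficients of
  \<open>x^j f\<close> reduced modulo \<open>x^n - 1\<close>, and column 0 those of
  \<open>f\<close>. The summand \<open>n\<close> keeps the subtraction of naturals exact.\<close>

definition circ :: "nat \<Rightarrow> 'a::comm_ring_1 poly \<Rightarrow> 'a mat" where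
  "circ n f = mat n n (\<lambda>(i, j). coeff f ((i + n - j) mod n))"

lemma circ_carrier [simp]: "circ n f \<in> carrier_mat n n"
  by (simp add: circ_def)

lemma mod_pred_nat: "i < n \<Longrightarrow> (i + n - 1) mod n = (if i = 0 then n - 1 else i - 1)" for i n :: nat
  by (cases i) auto

lemma circulant_index_shift:
  fixes i j n :: nat
  assumes "i < n" "j < n"
  shows "(i + n - (j + 1) mod n) mod n = ((i + n - 1) mod n + n - j) mod n"
proof (cases "j + 1 = n")
  case True
  have "i - 1 + n - j = i" if "i \<noteq> 0" using that True assms by linarith
  moreover have "n - 1 + n - j = n" using True by linarith
  ultimately show ?thesis
    unfolding mod_pred_nat[OF assms(1)] using True assms by simp
next
  case False
  then have j: "(j + 1) mod n = j + 1" "j + 1 < n" using assms by auto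
  have "i - 1 + n - j = i + n - (j + 1)" if "i \<noteq> 0" using that j assms by linarith
  moreover have "n - 1 + n - j = n - (j + 1) + n" using j by linarith
  ultimately show ?thesis
    unfolding mod_pred_nat[OF assms(1)] j(1) by simp
qed

lemma circulant_circ: "circulant n (circ n f)"
proof -
  have "coeff f ((i + n - (j + 1) mod n) mod n) = coeff f (((i + n - 1) mod n + n - j) mod n)"
    if "i < n" "j < n" for i j
  proof -
    have "(i + n - (j + 1) mod n) mod n = ((i + n - 1) mod n + n - j) mod n"
      using that by (rule circulant_index_shift)
    then show ?thesis by simp
  qed
  then show ?thesis by (auto simp: circulant_def circ_def)
qed

lemma poly_of_coeffs:
  assumes "n > 0"
  shows "degree (\<Sum>i<n. monom (c i) i) < n" and "coeff (\<Sum>i<n. monom (c i) i) k = (if k < n then c k else 0)"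
proof -
  show *: "coeff (\<Sum>i<n. monom (c i) i) k = (if k < n then c k else 0)" for k
    by (simp add: coeff_sum if_distrib cong: if_cong)
  show "degree (\<Sum>i<n. monom (c i) i) < n"
    using assms degree_le[of "n - 1" "\<Sum>i<n. monom (c i) i"] * by fastforce
qed

lemma circulant_imp_circ:
  assumes "n > 0" "circulant n A"
  shows "\<exists>f. degree f < n \<and> A = circ n f"
proof -
  have A: "A \<in> carrier_mat n n"
    and sh: "\<And>i j. i < n \<Longrightarrow> j < n \<Longrightarrow> A $$ (i, (j + 1) mod n) = A $$ ((i + n - 1) mod n, j)"
    using assms by (auto simp: circulant_def)
  \<comment> \<open>One step to the left along a diagonal lowers both indices, the row modulo
    \<open>n\<close>, so column 0 determines everything and supplies the coefficients of
    \<open>f\<close>.\<close>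
  have col: "A $$ (i, j) = A $$ ((i + n - j) mod n, 0)" if "i < n" "j < n" for i j
    using that
  proof (induction j arbitrary: i)
    case (Suc j)
    have "A $$ (i, Suc j) = A $$ ((i + n - 1) mod n, j)" using sh[of i j] Suc.prems by simp
    also have "\<dots> = A $$ (((i + n - 1) mod n + n - j) mod n, 0)" using Suc by simp
    also have "((i + n - 1) mod n + n - j) mod n = (i + n - Suc j) mod n"
      using circulant_index_shift[of i n j] Suc.prems by simp
    finally show ?case .
  qed (use A in simp)
  let ?f = "\<Sum>i<n. monom (A $$ (i, 0)) i"
  have "A = circ n ?f"
  proof (rule eq_matI)
    fix i j assume "i < dim_row (circ n ?f)" "j < dim_col (circ n ?f)"
    then have ij: "i < n" "j < n" by (auto simp: circ_def)
    show "A $$ (i, j) = circ n ?f $$ (i, j)"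
      unfolding col[OF ij] using ij assms(1) by (simp add: circ_def poly_of_coeffs)
  qed (use A in \<open>auto simp: circ_def\<close>)
  then show ?thesis by (intro exI[of _ ?f] conjI poly_of_coeffs(1)[OF assms(1)])
qed

lemma circ_inject:
  assumes "degree f < n" "degree g < n" "circ n f = circ n g"
  shows "f = g"
proof (rule poly_eqI)
  fix i
  show "coeff f i = coeff g i"
  proof (cases "i < n")
    case True
    then have "circ n f $$ (i, 0) = circ n g $$ (i, 0)" using assms by simp
    then show ?thesis using True by (simp add: circ_def)
  next
    case False
    then show ?thesis using assms by (simp add: coeff_eq_0)
  qed
qed

section \<open>Regular circulants as a subgroup of \<open>GL\<close>\<close>

definition shift_mat :: "nat \<Rightarrow> 'a::comm_ring_1 mat" where
  "shift_mat n = mat n n (\<lambda>(i, j). if i = (j + 1) mod n then 1 else 0)"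

text \<open>Modulo \<open>n\<close>, column \<open>j\<close> of \<open>A * shift_mat n\<close> is
  column \<open>j + 1\<close> of \<open>A\<close>, and row \<open>i\<close> of
  \<open>shift_mat n * A\<close> is row \<open>i - 1\<close> of \<open>A\<close>. Circulants thus
  form a centralizer, which gives closure under products and also under inverses, something the
  definition of \<open>RC\<close> does not build in.\<close>

lemma circulant_iff_commutes_shift:
  assumes A: "A \<in> carrier_mat n n"
  shows "circulant n A \<longleftrightarrow> A * shift_mat n = shift_mat n * A"
proof -
  have 1: "(A * shift_mat n) $$ (i, j) = A $$ (i, (j + 1) mod n)" if "i < n" "j < n" for i j
    using that A by (simp add: shift_mat_def scalar_prod_def if_distrib cong: if_cong)
  have 2: "(shift_mat n * A) $$ (i, j) = A $$ ((i + n - 1) mod n, j)" if ij: "i < n" "j < n" for i j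
  proof -
    have eq: "i = Suc k mod n \<longleftrightarrow> k = (i + n - 1) mod n" if "k < n" for k
      unfolding mod_pred_nat[OF ij(1)] using ij that by (cases "Suc k = n") auto
    have "(shift_mat n * A) $$ (i, j) = (\<Sum>k<n. (if k = (i + n - 1) mod n then 1 else 0) * A $$ (k, j))"
      using ij A eq by (auto simp: shift_mat_def scalar_prod_def lessThan_atLeast0 intro!: sum.cong)
    also have "\<dots> = A $$ ((i + n - 1) mod n, j)"
      using ij by (simp add: if_distribR if_distrib cong: if_cong)
    finally show ?thesis .
  qed
  have S: "shift_mat n \<in> carrier_mat n n" by (simp add: shift_mat_def)
  show ?thesis
  proof
    assume "circulant n A"
    then show "A * shift_mat n = shift_mat n * A"
      using A S 1 2 by (intro eq_matI) (auto simp: circulant_def simp del: index_mult_mat(1))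
  next
    assume "A * shift_mat n = shift_mat n * A"
    then show "circulant n A"
      using 1 2 A unfolding circulant_def by metis
  qed
qed

lemma carrier_GL: "carrier (GL n) = {A :: 'a::field mat. A \<in> carrier_mat n n \<and> det A \<noteq> 0}"
proof -
  have "Units (ring_mat TYPE('a) n ()) = {A. A \<in> carrier_mat n n \<and> det A \<noteq> 0}"
    using unit_imp_det_non_zero[of _ n "()"] det_non_zero_imp_unit[of _ n "()"]
    unfolding Units_def ring_mat_simps by blast
  then show ?thesis by (simp add: GL_def units_of_def)
qed

lemma mult_GL: "A \<otimes>\<^bsub>GL n\<^esub> B = A * B"
  by (simp add: GL_def units_of_def ring_mat_simps)

lemma one_GL: "\<one>\<^bsub>GL n\<^esub> = 1\<^sub>m n"
  by (simp add: GL_def units_of_def ring_mat_simps)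

lemma group_GL: "Group.group (GL n :: 'a::comm_ring_1 mat monoid)"
proof -
  interpret ring "ring_mat TYPE('a) n ()" by (rule ring_mat)
  show ?thesis unfolding GL_def by (rule units_group)
qed

lemma inv_GL:
  fixes A :: "'a::comm_ring_1 mat"
  assumes "A \<in> carrier (GL n)"
  shows "inv\<^bsub>GL n\<^esub> A * A = 1\<^sub>m n" "A * inv\<^bsub>GL n\<^esub> A = 1\<^sub>m n" "inv\<^bsub>GL n\<^esub> A \<in> carrier (GL n)"
proof -
  interpret Group.group "GL n :: 'a mat monoid" by (rule group_GL)
  show "inv\<^bsub>GL n\<^esub> A * A = 1\<^sub>m n" "A * inv\<^bsub>GL n\<^esub> A = 1\<^sub>m n" "inv\<^bsub>GL n\<^esub> A \<in> carrier (GL n)"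
    using assms l_inv r_inv by (auto simp: mult_GL one_GL)
qed

lemma carrier_RC: "carrier (RC n) = {A :: 'a::field mat. circulant n A \<and> det A \<noteq> 0}"
  by (auto simp: RC_def carrier_GL circulant_def)

lemma subgroup_RC: "subgroup (carrier (RC n)) (GL n :: 'a::field mat monoid)"
proof -
  interpret Group.group "GL n :: 'a mat monoid" by (rule group_GL)
  let ?P = "shift_mat n :: 'a mat"
  have P: "?P \<in> carrier_mat n n" by (simp add: shift_mat_def)
  have car: "carrier (RC n) = {A \<in> carrier (GL n). A * ?P = ?P * A}"
    using circulant_iff_commutes_shift by (auto simp: RC_def carrier_GL)
  show ?thesis
  proof (rule subgroupI)
    show "carrier (RC n) \<noteq> ({} :: 'a mat set)"
    proof -
      have "1\<^sub>m n \<in> carrier (RC n :: 'a mat monoid)" using P by (simp add: car carrier_GL)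
      then show ?thesis by blast
    qed
  next
    fix A :: "'a mat" assume "A \<in> carrier (RC n)"
    then have A: "A \<in> carrier (GL n)" and comm: "A * ?P = ?P * A" by (auto simp: car)
    define B where "B = inv\<^bsub>GL n\<^esub> A"
    have B: "B * A = 1\<^sub>m n" "A * B = 1\<^sub>m n" "B \<in> carrier (GL n)" using inv_GL[OF A] by (auto simp: B_def)
    have Ac: "A \<in> carrier_mat n n" and Bc: "B \<in> carrier_mat n n" using A B by (auto simp: carrier_GL)
    \<comment> \<open>With \<open>A P = P A\<close> and \<open>A B = B A = 1\<close>:
      \<open>B P = B P A B = B A P B = P B\<close>.\<close>
    have "B * ?P = B * (?P * (A * B))" using B P by simp
    also have "\<dots> = B * ((?P * A) * B)" using P Ac Bc by (simp add: assoc_mult_mat[of _ n n])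
    also have "\<dots> = B * ((A * ?P) * B)" by (simp add: comm)
    also have "\<dots> = (B * A) * ?P * B"
      using P Ac Bc by (simp add: assoc_mult_mat[of _ n n _ n _ n] mult_carrier_mat[of _ n n])
    also have "\<dots> = ?P * B" using B P by simp
    finally show "inv\<^bsub>GL n\<^esub> A \<in> carrier (RC n)" using B by (simp add: car B_def[symmetric])
  next
    fix A B :: "'a mat" assume "A \<in> carrier (RC n)" "B \<in> carrier (RC n)"
    then have A: "A \<in> carrier (GL n)" "A * ?P = ?P * A" and B: "B \<in> carrier (GL n)" "B * ?P = ?P * B"
      by (auto simp: car)
    have Ac: "A \<in> carrier_mat n n" and Bc: "B \<in> carrier_mat n n" using A B by (auto simp: carrier_GL)
    have "(A * B) * ?P = A * (?P * B)" using Ac Bc P B by (simp add: assoc_mult_mat[of _ n n])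
    also have "\<dots> = (A * ?P) * B" using Ac Bc P by (simp add: assoc_mult_mat[of _ n n])
    also have "\<dots> = (?P * A) * B" by (simp only: A(2))
    also have "\<dots> = ?P * (A * B)" using Ac Bc P by (simp add: assoc_mult_mat[of _ n n])
    finally show "A \<otimes>\<^bsub>GL n\<^esub> B \<in> carrier (RC n)"
      using A B m_closed[OF A(1) B(1)] by (simp add: car mult_GL)
  qed (auto simp: car)
qed

section \<open>Diagonalization by Taylor expansion\<close>

lemma diag_block_mat_index:
  assumes "\<And>A. A \<in> set As \<Longrightarrow> A \<in> carrier_mat N N" "i < length As * N" "j < length As * N"
  shows "diag_block_mat As $$ (i, j) =
    (if i div N = j div N then (As ! (i div N)) $$ (i mod N, j mod N) else 0)"
  using assms
proof (induction As arbitrary: i j)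
  case (Cons A As)
  have A: "A \<in> carrier_mat N N" and N: "N > 0" using Cons.prems by (auto intro: Nat.gr0I)
  have "map dim_row As = map (\<lambda>_. N) As" "map dim_col As = map (\<lambda>_. N) As"
    using Cons.prems by auto
  then have D: "dim_row (diag_block_mat As) = length As * N" "dim_col (diag_block_mat As) = length As * N"
    by (simp_all only: dim_diag_block_mat sum_list_triv) simp_all
  have sub: "i - N < length As * N \<and> (i - N) div N = i div N - 1 \<and> (i - N) mod N = i mod N \<and> i div N > 0"
    if "\<not> i < N" "i < length (A # As) * N" for i
    using that N by (auto simp: le_div_geq le_mod_geq div_greater_zero_iff)
  have blk: "diag_block_mat (A # As) $$ (i, j) = (if i < N then if j < N then A $$ (i, j) else 0
      else if j < N then 0 else diag_block_mat As $$ (i - N, j - N))"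
    using A D Cons.prems(2,3) by (simp add: Let_def carrier_matD[OF A])
  show ?case
  proof (cases "i < N \<or> j < N")
    case True
    then show ?thesis unfolding blk using sub[of i] sub[of j] Cons.prems(2,3) by auto
  next
    case False
    then show ?thesis
      unfolding blk using Cons.IH[of "i - N" "j - N"] Cons.prems sub[of i] sub[of j]
      by (auto simp: nth_Cons')
  qed
qed simp

definition toeplitz_blocks :: "nat \<Rightarrow> (nat \<Rightarrow> 'a::zero vec) \<Rightarrow> 'a mat" where
  "toeplitz_blocks m v = diag_block_mat (map (\<lambda>i. T_mat (v i)) [1..<Suc m])"

text \<open>Since \<open>coord\<close> is 1-based, coordinate \<open>N - b + a\<close> sits at
  position \<open>N - 1 - (b - a)\<close>; its index exceeds \<open>N\<close> exactly when
  \<open>a > b\<close>, hence the zeros below the diagonal.\<close>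

lemma T_mat_index:
  assumes "w \<in> carrier_vec N" "a < N" "b < N"
  shows "T_mat w $$ (a, b) = (if a \<le> b then w $ (N - 1 - (b - a)) else 0)"
proof -
  have "N - b + a - Suc 0 = N - Suc (b - a)" if "a \<le> b" using assms that by simp
  then show ?thesis using assms by (auto simp: T_mat_def coord_def Let_def)
qed

lemma div_less_if_less_mult: "k < m * N \<Longrightarrow> k div N < m" for k m N :: nat
  by (simp add: less_mult_imp_div_less)

lemma toeplitz_blocks_carrier:
  assumes "\<And>i. i \<in> {1..m} \<Longrightarrow> v i \<in> carrier_vec N"
  shows "toeplitz_blocks m v \<in> carrier_mat (m * N) (m * N)"
proof -
  have eq: "map dim_row (map (\<lambda>i. T_mat (v i)) [1..<Suc m]) = map (\<lambda>_. N) [1..<Suc m]"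
    "map dim_col (map (\<lambda>i. T_mat (v i)) [1..<Suc m]) = map (\<lambda>_. N) [1..<Suc m]"
    using assms by (auto simp: T_mat_def Let_def)
  show ?thesis
    unfolding toeplitz_blocks_def
    by (rule carrier_matI) (simp_all only: dim_diag_block_mat eq sum_list_triv, simp_all)
qed

lemma toeplitz_blocks_index:
  assumes "\<And>i. i \<in> {1..m} \<Longrightarrow> v i \<in> carrier_vec N" "k < m * N" "l < m * N"
  shows "toeplitz_blocks m v $$ (k, l) = (if k div N = l div N \<and> k mod N \<le> l mod N
    then v (Suc (k div N)) $ (N - 1 - (l mod N - k mod N)) else 0)"
proof -
  have N: "N > 0" using assms(2) by (auto intro: Nat.gr0I)
  have k: "k div N < m" using div_less_if_less_mult assms by blast
  have "toeplitz_blocks m v $$ (k, l) = (if k div N = l div N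
      then (map (\<lambda>i. T_mat (v i)) [1..<Suc m] ! (k div N)) $$ (k mod N, l mod N) else 0)"
    unfolding toeplitz_blocks_def
  proof (rule diag_block_mat_index)
    fix A assume "A \<in> set (map (\<lambda>i. T_mat (v i)) [1..<Suc m])"
    then obtain i where i: "i \<in> set [1..<Suc m]" "A = T_mat (v i)" by (auto simp del: set_upt)
    then have "v i \<in> carrier_vec N" using assms(1) by auto
    then show "A \<in> carrier_mat N N" by (simp add: i(2) T_mat_def Let_def)
  qed (use assms(2,3) k in simp_all)
  moreover have "map (\<lambda>i. T_mat (v i)) [1..<Suc m] ! (k div N) = T_mat (v (Suc (k div N)))"
    using k by simp
  ultimately show ?thesis
    using T_mat_index[OF assms(1), of "Suc (k div N)" "k mod N" "l mod N"] k N by auto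
qed

text \<open>The matrix is upper triangular, and its diagonal repeats the last coordinate of each
  \<open>v i\<close> along block \<open>i\<close>.\<close>

lemma det_toeplitz_blocks_eq_0_iff:
  fixes v :: "nat \<Rightarrow> 'a::field vec"
  assumes v: "\<And>i. i \<in> {1..m} \<Longrightarrow> v i \<in> carrier_vec N" and N: "N > 0"
  shows "det (toeplitz_blocks m v) = 0 \<longleftrightarrow> (\<exists>i\<in>{1..m}. coord (v i) N = 0)"
proof -
  let ?B = "toeplitz_blocks m v"
  have car: "?B \<in> carrier_mat (m * N) (m * N)" using toeplitz_blocks_carrier[OF v] .
  have diag: "?B $$ (k, k) = v (Suc (k div N)) $ (N - 1)" if "k < m * N" for k
    using toeplitz_blocks_index[OF v that that] by simp
  have "?B $$ (i, j) = 0" if "i < m * N" "j < i" for i j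
  proof -
    have "\<not> (i div N = j div N \<and> i mod N \<le> j mod N)"
    proof
      assume *: "i div N = j div N \<and> i mod N \<le> j mod N"
      then have "i div N * N + i mod N \<le> j div N * N + j mod N" by (intro add_mono) simp_all
      then show False using that by (simp only: div_mult_mod_eq)
    qed
    then show ?thesis using toeplitz_blocks_index[of m v N i j] v that by auto
  qed
  then have "upper_triangular ?B" using car by auto
  then have "det ?B = 0 \<longleftrightarrow> (\<exists>k<m * N. v (Suc (k div N)) $ (N - 1) = 0)"
  proof -
    assume "upper_triangular ?B"
    then have "det ?B = 0 \<longleftrightarrow> 0 \<in> set (diag_mat ?B)"
      by (rule upper_triangular_imp_det_eq_0_iff[OF car])
    also have "set (diag_mat ?B) = (\<lambda>k. ?B $$ (k, k)) ` {..<m * N}"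
      unfolding diag_mat_def using car by (auto simp: lessThan_atLeast0)
    also have "\<dots> = (\<lambda>k. v (Suc (k div N)) $ (N - 1)) ` {..<m * N}"
      using diag by (intro image_cong) auto
    finally show ?thesis by (auto simp: image_iff eq_commute[of 0])
  qed
  also have "\<dots> \<longleftrightarrow> (\<exists>i\<in>{1..m}. v i $ (N - 1) = 0)"
  proof
    assume "\<exists>k<m * N. v (Suc (k div N)) $ (N - 1) = 0"
    then obtain k where "k < m * N" "v (Suc (k div N)) $ (N - 1) = 0" by blast
    then show "\<exists>i\<in>{1..m}. v i $ (N - 1) = 0"
      using div_less_if_less_mult[of k m N] by (intro bexI[of _ "Suc (k div N)"]) auto
  next
    assume "\<exists>i\<in>{1..m}. v i $ (N - 1) = 0"
    then obtain i where i: "i \<in> {1..m}" "v i $ (N - 1) = 0" by blast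
    \<comment> \<open>Position \<open>(i - 1) * N\<close> is the first diagonal entry of block
      \<open>i\<close>.\<close>
    then have "(i - 1) * N < m * N" using N by auto
    moreover have "Suc ((i - 1) * N div N) = i" using N i by simp
    ultimately show "\<exists>k<m * N. v (Suc (k div N)) $ (N - 1) = 0" using i(2) by metis
  qed
  also have "\<dots> \<longleftrightarrow> (\<exists>i\<in>{1..m}. coord (v i) N = 0)"
  proof (rule bex_cong)
    fix i assume "i \<in> {1..m}"
    from v[OF this] show "v i $ (N - 1) = 0 \<longleftrightarrow> coord (v i) N = 0" by (simp add: coord_def)
  qed simp
  finally show ?thesis .
qed

text \<open>The order is reversed so that \<open>f(z)\<close> becomes the last coordinate. Then
  \<open>T_mat\<close> of this vector is multiplication by \<open>f\<close> modulo
  \<open>(x - z)^N\<close> in the basis \<open>(x - z)^(N-1), ..., 1\<close>.\<close>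

definition taylor_vec :: "nat \<Rightarrow> 'a::comm_ring_1 \<Rightarrow> 'a poly \<Rightarrow> 'a vec" where
  "taylor_vec N z f = vec N (\<lambda>l. taylor_coeff z f (N - 1 - l))"

lemma taylor_vec_carrier [simp]: "taylor_vec N z f \<in> carrier_vec N"
  by (simp add: taylor_vec_def)

lemma taylor_vec_index: "d < N \<Longrightarrow> taylor_vec N z f $ (N - 1 - d) = taylor_coeff z f d"
  by (simp add: taylor_vec_def)

lemma coord_taylor_vec: "N > 0 \<Longrightarrow> coord (taylor_vec N z f) N = poly f z"
  by (simp add: coord_def taylor_vec_def taylor_coeff_0_right)

text \<open>In the quotient by \<open>x^n - 1\<close>, the matrix \<open>circ n f\<close> acts by multiplication with \<open>f\<close>.\<close>

lemma circ_column_cong: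
  fixes f :: "'a::comm_ring_1 poly"
  assumes "degree f < n" "j < n"
  shows "monom 1 n - 1 dvd monom 1 j * f - (\<Sum>l<n. monom (coeff f ((l + n - j) mod n)) l)"
proof -
  have n: "n > 0" using assms by simp
  have "f = (\<Sum>i<n. monom (coeff f i) i)"
    using assms(1) n by (intro poly_eqI) (auto simp: poly_of_coeffs coeff_eq_0)
  then have "monom 1 j * f = (\<Sum>i<n. monom (coeff f i) (i + j))"
    by (metis (no_types, lifting) sum_distrib_left mult_monom mult_1 add.commute sum.cong)
  moreover have "(\<Sum>l<n. monom (coeff f ((l + n - j) mod n)) l) =
      (\<Sum>i<n. monom (coeff f i) ((i + j) mod n))"
  proof (rule sum.reindex_bij_witness[where i = "\<lambda>i. (i + j) mod n" and j = "\<lambda>l. (l + n - j) mod n"])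
    fix l assume "l \<in> {..<n}"
    then have "((l + n - j) mod n + j) mod n = (l + n - j + j) mod n" by (simp add: mod_add_left_eq)
    also have "\<dots> = l" using \<open>l \<in> {..<n}\<close> assms by simp
    finally show "((l + n - j) mod n + j) mod n = l" .
    then show "monom (coeff f ((l + n - j) mod n)) (((l + n - j) mod n + j) mod n)
      = monom (coeff f ((l + n - j) mod n)) l" by simp
  next
    fix i assume i: "i \<in> {..<n}"
    have "((i + j) mod n + n - j) mod n = ((i + j) mod n + (n - j)) mod n" using assms by simp
    also have "\<dots> = (i + j + (n - j)) mod n" by (simp add: mod_add_left_eq)
    also have "i + j + (n - j) = i + n" using assms by simp
    finally show "((i + j) mod n + n - j) mod n = i" using i by simp
  qed (use n in auto)
  ultimately have "monom 1 j * f - (\<Sum>l<n. monom (coeff f ((l + n - j) mod n)) l) =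
      (\<Sum>i<n. monom (coeff f i) (i + j) - monom (coeff f i) ((i + j) mod n))"
    by (simp add: sum_subtractf)
  then show ?thesis by (auto intro!: dvd_sum monom_mod_dvd)
qed

text \<open>Since \<open>m * N = n\<close>, the distinct \<open>Z i\<close> with multiplicity
  \<open>N\<close> account for all of \<open>x^n - 1\<close>. How that multiplicity arises from the
  characteristic is left to the instances.\<close>

locale circulant_spectrum =
  fixes m N n :: nat and Z :: "nat \<Rightarrow> 'a::field"
  assumes m_pos: "m > 0" and N_pos: "N > 0" and n_eq: "n = m * N"
    and inj_Z: "inj_on Z {1..m}"
    and Z_dvd: "\<And>i. i \<in> {1..m} \<Longrightarrow> [:- Z i, 1:] ^ N dvd monom 1 n - 1"
begin

text \<open>A confluent Vandermonde matrix: rows belong to roots and Taylor orders, columns to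
  monomials. Inside a block the order descends from \<open>N - 1\<close> to 0, as in
  \<open>taylor_vec\<close>. This is the conjugating element of (ii).\<close>

definition taylor_mat :: "'a mat" where
  "taylor_mat = mat n n (\<lambda>(k, j). taylor_coeff (Z (Suc (k div N))) (monom 1 j) (N - 1 - k mod N))"

lemma taylor_mat_carrier [simp]: "taylor_mat \<in> carrier_mat n n"
  by (simp add: taylor_mat_def)

lemma n_pos: "n > 0"
  using m_pos N_pos n_eq by simp

lemma block_in_range: "k < n \<Longrightarrow> Suc (k div N) \<in> {1..m}"
  using div_less_if_less_mult[of k m N] n_eq by auto

lemma eq_if_taylor_eq:
  assumes "degree f < n" "degree g < n"
    "\<And>i e. i \<in> {1..m} \<Longrightarrow> e < N \<Longrightarrow> taylor_coeff (Z i) f e = taylor_coeff (Z i) g e"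
  shows "f = g"
proof -
  have "f - g = 0"
  proof (rule eq_0_if_linear_powers_dvd)
    show "finite (Z ` {1..m})" by simp
    show "degree (f - g) < N * card (Z ` {1..m})"
      using assms(1,2) degree_diff_less[of f n g] inj_Z n_eq by (simp add: card_image mult.commute)
    show "[:- a, 1:] ^ N dvd f - g" if "a \<in> Z ` {1..m}" for a
      using that assms(3) by (auto simp: taylor_coeff_diff simp flip: taylor_coeff_eq_0_iff)
  qed
  then show ?thesis by simp
qed

lemma taylor_mat_mult_vec:
  assumes "c \<in> carrier_vec n" "k < n"
  shows "(taylor_mat *\<^sub>v c) $ k =
    taylor_coeff (Z (Suc (k div N))) (\<Sum>j<n. monom (c $ j) j) (N - 1 - k mod N)"
  using assms
  by (simp add: taylor_mat_def scalar_prod_def taylor_coeff_sum taylor_coeff_monom[of _ "c $ _"]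
      lessThan_atLeast0 mult.commute)

text \<open>A kernel vector lists the coefficients of a polynomial of degree below \<open>n\<close>
  that is divisible by every \<open>(x - Z i)^N\<close>; such a polynomial is 0.\<close>

lemma det_taylor_mat: "det taylor_mat \<noteq> 0"
proof
  assume "det taylor_mat = 0"
  then obtain c where c: "c \<in> carrier_vec n" "c \<noteq> 0\<^sub>v n" "taylor_mat *\<^sub>v c = 0\<^sub>v n"
    using det_0_iff_vec_prod_zero[OF taylor_mat_carrier] by auto
  let ?h = "\<Sum>j<n. monom (c $ j) j"
  have "taylor_coeff (Z i) ?h e = 0" if "i \<in> {1..m}" "e < N" for i e
  proof -
    \<comment> \<open>The row that holds order \<open>e\<close> at \<open>Z i\<close>.\<close>
    let ?k = "(i - 1) * N + (N - 1 - e)"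
    have lt: "N - 1 - e < N" using N_pos by simp
    have "?k < (i - 1) * N + N" using lt by simp
    also have "\<dots> = i * N" using that by (cases i) auto
    also have "\<dots> \<le> n" using that n_eq by simp
    finally have k: "?k < n" .
    have d: "?k div N = i - 1" "?k mod N = N - 1 - e" using lt by auto
    have "(taylor_mat *\<^sub>v c) $ ?k = 0" using c(3) k by simp
    then show ?thesis unfolding taylor_mat_mult_vec[OF c(1) k] d using that by simp
  qed
  then have "?h = 0"
    using n_pos by (intro eq_if_taylor_eq poly_of_coeffs(1)) (auto simp: taylor_coeff_def)
  then have "c $ j = 0" if "j < n" for j
    using poly_of_coeffs(2)[OF n_pos, of "\<lambda>j. c $ j" j] that by simp
  then show False using c by auto
qed

text \<open>Hermite interpolation, obtained by applying the inverse of \<open>taylor_mat\<close> to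
  the prescribed values.\<close>

lemma exists_taylor:
  "\<exists>f. degree f < n \<and> (\<forall>i\<in>{1..m}. \<forall>e<N. taylor_coeff (Z i) f e = u i e)"
proof -
  have "taylor_mat \<in> carrier (GL n)" using det_taylor_mat by (simp add: carrier_GL)
  from inv_GL[OF this] obtain H where H: "H \<in> carrier_mat n n" "taylor_mat * H = 1\<^sub>m n"
    by (auto simp: carrier_GL)
  define b where "b = vec n (\<lambda>k. u (Suc (k div N)) (N - 1 - k mod N))"
  define c where "c = H *\<^sub>v b"
  have bc: "b \<in> carrier_vec n" "c \<in> carrier_vec n" using H by (auto simp: b_def c_def)
  have "taylor_mat *\<^sub>v c = b"
    unfolding c_def using H bc(1) by (simp add: assoc_mult_mat_vec[of _ n n _ n, symmetric])
  let ?h = "\<Sum>j<n. monom (c $ j) j"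
  have "taylor_coeff (Z i) ?h e = u i e" if "i \<in> {1..m}" "e < N" for i e
  proof -
    let ?k = "(i - 1) * N + (N - 1 - e)"
    have lt: "N - 1 - e < N" using N_pos by simp
    have "?k < (i - 1) * N + N" using lt by simp
    also have "\<dots> = i * N" using that by (cases i) auto
    also have "\<dots> \<le> n" using that n_eq by simp
    finally have k: "?k < n" .
    have d: "?k div N = i - 1" "?k mod N = N - 1 - e" using lt by auto
    have "(taylor_mat *\<^sub>v c) $ ?k = u i e"
      using \<open>taylor_mat *\<^sub>v c = b\<close> k d that by (simp add: b_def)
    then show ?thesis unfolding taylor_mat_mult_vec[OF bc(2) k] d using that by simp
  qed
  then show ?thesis by (intro exI[of _ ?h] conjI poly_of_coeffs(1) n_pos) auto
qed

text \<open>Column \<open>j\<close> of either side lists the Taylor coefficients of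
  \<open>x^j f\<close>: on the left because column \<open>j\<close> of \<open>circ n f\<close> is
  \<open>x^j f\<close> modulo \<open>x^n - 1\<close>, on the right because a row of a Toeplitz block
  applied to the expansion of \<open>x^j\<close> is a Cauchy product.\<close>

lemma taylor_mat_circ:
  assumes f: "degree f < n"
  shows "taylor_mat * circ n f = toeplitz_blocks m (\<lambda>i. taylor_vec N (Z i) f) * taylor_mat"
    (is "?L = ?B * taylor_mat")
proof (rule eq_matI)
  have B: "?B \<in> carrier_mat n n" unfolding n_eq by (rule toeplitz_blocks_carrier) simp
  then show "dim_row ?L = dim_row (?B * taylor_mat)" "dim_col ?L = dim_col (?B * taylor_mat)"
    using carrier_matD[OF taylor_mat_carrier] by (auto simp: circ_def)
  fix k j assume "k < dim_row (?B * taylor_mat)" "j < dim_col (?B * taylor_mat)"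
  then have kj: "k < n" "j < n" using B by (auto simp: taylor_mat_def)
  define z where "z = Z (Suc (k div N))"
  define a where "a = k mod N"
  have a: "a < N" using N_pos by (simp add: a_def)
  let ?p = "\<Sum>l<n. monom (coeff f ((l + n - j) mod n)) l"
  have "?L $$ (k, j) = taylor_coeff z ?p (N - 1 - a)"
    using kj
    by (simp add: taylor_mat_def circ_def scalar_prod_def taylor_coeff_sum z_def a_def
        taylor_coeff_monom[of _ "coeff f _"] lessThan_atLeast0 mult.commute)
  also have "\<dots> = taylor_coeff z (monom 1 j * f) (N - 1 - a)"
  proof -
    \<comment> \<open>Reduction modulo \<open>x^n - 1\<close> leaves the orders below
      \<open>N\<close> at \<open>z\<close> unchanged.\<close>
    have "[:- z, 1:] ^ N dvd monom 1 j * f - ?p"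
      using Z_dvd[OF block_in_range[OF kj(1)]] circ_column_cong[OF f kj(2)]
      unfolding z_def by (rule dvd_trans)
    then have "taylor_coeff z (monom 1 j * f - ?p) (N - 1 - a) = 0"
      using a unfolding taylor_coeff_eq_0_iff[symmetric] by auto
    then show ?thesis by (simp add: taylor_coeff_diff)
  qed
  also have "\<dots> = (\<Sum>i\<le>N - 1 - a. taylor_coeff z f i * taylor_coeff z (monom 1 j) (N - 1 - a - i))"
    by (subst mult.commute) (rule taylor_coeff_mult)
  \<comment> \<open>Here \<open>b = a + i\<close>: offset \<open>b\<close> inside a block stands for
    order \<open>N - 1 - b\<close>.\<close>
  also have "\<dots> = (\<Sum>b\<in>{a..<N}. taylor_coeff z f (b - a) * taylor_coeff z (monom 1 j) (N - 1 - b))"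
    using a by (intro sum.reindex_bij_witness[where i = "\<lambda>b. b - a" and j = "\<lambda>i. i + a"])
      (auto simp: algebra_simps)
  also have "\<dots> = (\<Sum>l<n. ?B $$ (k, l) * taylor_mat $$ (l, j))"
  proof -
    have idx: "?B $$ (k, l) = (if k div N = l div N \<and> a \<le> l mod N
        then taylor_coeff z f (l mod N - a) else 0)" if "l < n" for l
    proof -
      have "l mod N - a < N" using N_pos mod_less_divisor[of N l] by linarith
      note tv = taylor_vec_index[OF this, of z f]
      have "?B $$ (k, l) = (if k div N = l div N \<and> a \<le> l mod N
          then taylor_vec N z f $ (N - 1 - (l mod N - a)) else 0)"
        unfolding z_def a_def by (rule toeplitz_blocks_index) (use that kj n_eq in auto)
      then show ?thesis unfolding tv .
    qed
    \<comment> \<open>Only columns of the block containing \<open>k\<close>, at or to the right of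
      the diagonal, contribute.\<close>
    have "(\<Sum>l<n. ?B $$ (k, l) * taylor_mat $$ (l, j)) =
        (\<Sum>l\<in>{l\<in>{..<n}. k div N = l div N \<and> a \<le> l mod N}.
          taylor_coeff z f (l mod N - a) * taylor_coeff z (monom 1 j) (N - 1 - l mod N))"
      using kj by (intro sum.mono_neutral_cong_right)
        (auto simp: idx taylor_mat_def z_def split: if_splits)
    also have "\<dots> = (\<Sum>b\<in>{a..<N}. taylor_coeff z f (b - a) * taylor_coeff z (monom 1 j) (N - 1 - b))"
    proof (rule sum.reindex_bij_witness[where i = "\<lambda>b. k div N * N + b" and j = "\<lambda>l. l mod N"])
      fix b assume b: "b \<in> {a..<N}"
      have "k div N * N + b < Suc (k div N) * N" using b by simp
      also have "\<dots> \<le> m * N" using block_in_range[OF kj(1)] by (intro mult_le_mono1) auto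
      finally show "k div N * N + b \<in> {l\<in>{..<n}. k div N = l div N \<and> a \<le> l mod N}"
        using b by (auto simp: n_eq)
    qed (use N_pos in auto)
    finally show ?thesis by simp
  qed
  also have "\<dots> = (?B * taylor_mat) $$ (k, j)"
    using kj B carrier_matD[OF taylor_mat_carrier] by (simp add: scalar_prod_def lessThan_atLeast0)
  finally show "?L $$ (k, j) = (?B * taylor_mat) $$ (k, j)" .
qed

lemma det_circ_eq_0_iff:
  assumes "degree f < n"
  shows "det (circ n f) = 0 \<longleftrightarrow> (\<exists>i\<in>{1..m}. poly f (Z i) = 0)"
proof -
  let ?B = "toeplitz_blocks m (\<lambda>i. taylor_vec N (Z i) f)"
  have B: "?B \<in> carrier_mat n n" unfolding n_eq by (rule toeplitz_blocks_carrier) simp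
  have "det (circ n f) = det ?B"
    using arg_cong[OF taylor_mat_circ[OF assms], of det] det_taylor_mat
    by (simp add: det_mult[OF taylor_mat_carrier circ_carrier] det_mult[OF B taylor_mat_carrier])
  then show ?thesis
    using det_toeplitz_blocks_eq_0_iff[of m "\<lambda>i. taylor_vec N (Z i) f" N] N_pos
    by (simp add: coord_taylor_vec)
qed

end

lemma taylor_coeff_hom:
  assumes "comm_ring_hom h"
  shows "taylor_coeff (h z) (map_poly h f) e = h (taylor_coeff z f e)"
proof -
  interpret comm_ring_hom h by (rule assms)
  have "map_poly h (pcompose f [:z, 1:]) = pcompose (map_poly h f) [:h z, 1:]"
    by (simp add: map_poly_pcompose)
  then show ?thesis by (metis taylor_coeff_def coeff_map_poly hom_zero)
qed

lemma frobenius_field_hom: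
  assumes "Factorial_Ring.prime CHAR('a::field)" "Q = CHAR('a) ^ u"
  shows "field_hom (\<lambda>x::'a. x ^ Q)"
proof -
  have "Q > 0" using assms prime_gt_0_nat by simp
  then show ?thesis
    using freshmans_dream'[OF assms]
    by unfold_locales (auto simp: power_mult_distrib)
qed

section \<open>Cycles of the multiplication permutation\<close>

lemma foldr_cycles_outside:
  "x \<notin> set (concat cs) \<Longrightarrow> foldr (\<circ>) (map cycle_of_list cs) id x = x"
  by (induction cs) (auto simp: id_outside_supp)

lemma foldr_cycles_inside:
  assumes "distinct (concat cs)" "c \<in> set cs" "x \<in> set c"
  shows "foldr (\<circ>) (map cycle_of_list cs) id x = cycle_of_list c x"
  using assms
proof (induction cs)
  case (Cons d cs)
  show ?case
  proof (cases "x \<in> set d")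
    case True
    then have "x \<notin> set (concat cs)" using Cons.prems by auto
    moreover have "c = d" using Cons.prems True by auto
    moreover have "foldr (\<circ>) (map cycle_of_list (d # cs)) id x =
        cycle_of_list d (foldr (\<circ>) (map cycle_of_list cs) id x)" by simp
    ultimately show ?thesis using foldr_cycles_outside[of x cs] by metis
  next
    case False
    then have c: "c \<in> set cs" using Cons.prems by auto
    have "distinct c" using Cons.prems by (auto simp: distinct_concat_iff)
    then have "cycle_of_list c x \<in> set c" using cycle_is_surj Cons.prems by blast
    moreover have "set c \<inter> set d = {}" using Cons.prems c by auto
    ultimately have "cycle_of_list d (cycle_of_list c x) = cycle_of_list c x"
      by (intro id_outside_supp) auto
    then show ?thesis using Cons c by simp
  qed
qed simp

lemma cycle_decomposition_nth:
  assumes "cycle_decomposition A f cs" "c \<in> set cs" "i < length c"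
  shows "f (c ! i) = c ! (Suc i mod length c)"
proof -
  have d: "distinct (concat cs)" "f = foldr (\<circ>) (map cycle_of_list cs) id"
    using assms by (auto simp: cycle_decomposition_def)
  then have "distinct c" using assms by (auto simp: distinct_concat_iff)
  from cyclic_rotation[OF this, of 1] have "map (cycle_of_list c) c = rotate1 c" by simp
  then have "cycle_of_list c (c ! i) = rotate1 c ! i" using assms(3) by (metis nth_map)
  then show ?thesis
    using foldr_cycles_inside[OF d(1) assms(2)] assms(3) d(2) by (simp add: nth_rotate1)
qed

lemma cycle_decomposition_exists:
  assumes "f permutes A" "finite A"
  shows "\<exists>cs. cycle_decomposition A f cs"
  using Cycles.cycle_decomposition[OF assms]
proof (induction rule: cycle_decomp.induct)
  case empty
  show ?case by (intro exI[of _ "[]"]) (simp add: cycle_decomposition_def id_def)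
next
  case (comp I g c)
  then obtain cs where cs: "cycle_decomposition I g cs" by blast
  show ?case
  proof (cases "c = []")
    \<comment> \<open>\<open>cycle_decomp\<close> admits an empty cycle, which acts as the identity;
      it is dropped because \<open>cycle_decomposition\<close> excludes it.\<close>
    case True
    then show ?thesis using cs by auto
  next
    case False
    then show ?thesis
      using cs comp by (intro exI[of _ "c # cs"]) (auto simp: cycle_decomposition_def)
  qed
qed

lemma cycle_decomposition_unique:
  assumes "cycle_decomposition A f cs" "c \<in> set cs" "i < length c" "d \<in> set cs" "j < length d"
    "c ! i = d ! j"
  shows "c = d \<and> i = j"
proof -
  have dist: "distinct (concat cs)" using assms(1) by (simp add: cycle_decomposition_def)
  have "c ! i \<in> set c \<inter> set d" using assms nth_mem by (metis IntI)
  then have "c = d" using dist assms(2,4) unfolding distinct_concat_iff by blast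
  moreover have "distinct c" using dist assms(2) by (simp add: distinct_concat_iff)
  ultimately show ?thesis using assms nth_eq_iff_index_eq by metis
qed

lemma cycle_decomposition_cover:
  assumes "cycle_decomposition A f cs"
  shows "x \<in> A \<longleftrightarrow> (\<exists>c\<in>set cs. \<exists>i<length c. x = c ! i)"
proof -
  have "A = set (concat cs)" using assms by (simp add: cycle_decomposition_def)
  then show ?thesis by (auto simp: in_set_conv_nth)
qed

lemma cycle_decomposition_length_pos:
  "cycle_decomposition A f cs \<Longrightarrow> c \<in> set cs \<Longrightarrow> length c > 0"
  by (auto simp: cycle_decomposition_def)

text \<open>Every element of \<open>A\<close> has exactly one cycle and position, so values may be
  prescribed by position. Serves to label the roots and to extend vectors along cycles.\<close>

lemma cycle_decomposition_define:
  assumes "cycle_decomposition A f cs"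
  shows "\<exists>F. \<forall>c\<in>set cs. \<forall>i<length c. F (c ! i) = h c i"
proof -
  define F where "F x = (case (SOME ci. fst ci \<in> set cs \<and> snd ci < length (fst ci) \<and> x = fst ci ! snd ci)
    of (c, i) \<Rightarrow> h c i)" for x
  have "F (c ! i) = h c i" if "c \<in> set cs" "i < length c" for c i
  proof -
    have "(SOME ci. fst ci \<in> set cs \<and> snd ci < length (fst ci) \<and> c ! i = fst ci ! snd ci) = (c, i)"
    proof (rule some_equality)
      fix ci assume "fst ci \<in> set cs \<and> snd ci < length (fst ci) \<and> c ! i = fst ci ! snd ci"
      then show "ci = (c, i)"
        using cycle_decomposition_unique[OF assms that, of "fst ci" "snd ci"] by (cases ci) auto
    qed (use that in auto)
    then show ?thesis by (simp add: F_def)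
  qed
  then show ?thesis by blast
qed

locale frobenius_cycles =
  fixes p t m :: nat and cs :: "nat list list"
  assumes coprime_pm: "coprime p m" and m_pos: "m > 0"
    and cs: "cycle_decomposition {1..m} (sigma p t m) cs"

section \<open>Arithmetic of \<open>sigma\<close> and the lengths of its cycles\<close>

lemma residue_rep:
  assumes "m > 0"
  shows "residue_rep m z \<in> {1..m}" "[int (residue_rep m z) = z] (mod int m)"
proof -
  have b: "0 \<le> z mod int m" "z mod int m < int m" using assms by auto
  show "residue_rep m z \<in> {1..m}"
  proof (cases "z mod int m = 0")
    case False
    then have "1 \<le> z mod int m" using b by linarith
    then have "1 \<le> nat (z mod int m)" "nat (z mod int m) \<le> m" using b(2) by linarith+
    then show ?thesis using False by (simp add: residue_rep_def)
  qed (use assms in \<open>simp add: residue_rep_def\<close>)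
  show "[int (residue_rep m z) = z] (mod int m)"
    using b by (auto simp: residue_rep_def cong_def)
qed

lemma cong_imp_eq_in_range:
  fixes x y m :: nat
  assumes "[x = y] (mod m)" "x \<in> {1..m}" "y \<in> {1..m}"
  shows "x = y"
proof -
  have "m > 0" using assms by auto
  \<comment> \<open>Subtracting 1 moves the representatives \<open>1..m\<close> to
    \<open>0..m-1\<close>, where congruence means equality.\<close>
  have "[x - 1 + 1 = y - 1 + 1] (mod m)" using assms by simp
  then have "[x - 1 = y - 1] (mod m)" by (simp only: cong_add_rcancel_nat)
  then have "x - 1 = y - 1" using assms \<open>m > 0\<close> by (intro cong_less_modulus_unique_nat[of _ _ m]) auto
  then show ?thesis using assms by auto
qed

text \<open>Multiplying by \<open>p ^ t\<close> clears the modular inverse; the later arithmetic of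
  \<open>sigma\<close> runs through this congruence.\<close>

lemma sigma_cong:
  assumes "coprime p m" "m > 0" "x \<in> {1..m}"
  shows "sigma p t m x \<in> {1..m}" "[p ^ t * sigma p t m x = x] (mod m)"
proof -
  let ?z = "modular_inverse (int m) (int p ^ t) * int x"
  have s: "sigma p t m x = residue_rep m ?z" using assms(3) by (auto simp: sigma_def)
  then show "sigma p t m x \<in> {1..m}" using residue_rep(1)[OF assms(2)] by simp
  have "coprime (int m) (int p ^ t)" using assms(1) by (simp add: coprime_commute)
  then have "[int p ^ t * modular_inverse (int m) (int p ^ t) = 1] (mod int m)"
    by (intro cong_modular_inverse1) (simp add: coprime_commute)
  then have 1: "[int p ^ t * modular_inverse (int m) (int p ^ t) * int x = 1 * int x] (mod int m)"
    by (rule cong_scalar_right)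
  have "[int p ^ t * int (sigma p t m x) = int p ^ t * ?z] (mod int m)"
    unfolding s by (intro cong_scalar_left residue_rep assms)
  with 1 have "[int (p ^ t * sigma p t m x) = int x] (mod int m)"
    using cong_trans by (fastforce simp: mult.assoc)
  then show "[p ^ t * sigma p t m x = x] (mod m)" by (simp only: cong_int_iff)
qed

lemma sigma_permutes:
  assumes "coprime p m" "m > 0"
  shows "sigma p t m permutes {1..m}"
proof (rule bij_imp_permutes)
  have "inj_on (sigma p t m) {1..m}"
  proof (rule inj_onI)
    fix x y assume xy: "x \<in> {1..m}" "y \<in> {1..m}" "sigma p t m x = sigma p t m y"
    have "[x = y] (mod m)"
      using sigma_cong(2)[OF assms xy(1), of t] sigma_cong(2)[OF assms xy(2), of t] xy(3)
      by (metis cong_sym cong_trans)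
    then show "x = y" using xy by (intro cong_imp_eq_in_range)
  qed
  moreover have "sigma p t m ` {1..m} \<subseteq> {1..m}" using sigma_cong(1)[OF assms] by blast
  ultimately show "bij_betw (sigma p t m) {1..m} {1..m}"
    by (simp add: bij_betw_def endo_inj_surj)
qed (auto simp: sigma_def)

context frobenius_cycles
begin

lemma cycle_nth_range: "c \<in> set cs \<Longrightarrow> i < length c \<Longrightarrow> c ! i \<in> {1..m}"
  using cycle_decomposition_cover[OF cs] by blast

lemma cycle_nth_cong:
  assumes "c \<in> set cs" "i < length c"
  shows "[p ^ t * c ! (Suc i mod length c) = c ! i] (mod m)"
  using sigma_cong(2)[OF coprime_pm m_pos cycle_nth_range[OF assms], of t]
  unfolding cycle_decomposition_nth[OF cs assms] .

lemma cycle_nth_pow_cong: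
  assumes c: "c \<in> set cs"
  shows "[(p ^ t) ^ i * c ! (i mod length c) = c ! 0] (mod m)"
proof (induction i)
  case (Suc i)
  have L: "length c > 0" using cycle_decomposition_length_pos[OF cs c] .
  have "[(p ^ t) ^ i * (p ^ t * c ! (Suc (i mod length c) mod length c)) =
      (p ^ t) ^ i * c ! (i mod length c)] (mod m)"
    using L by (intro cong_scalar_left cycle_nth_cong c) auto
  then have "[(p ^ t) ^ Suc i * c ! (Suc i mod length c) = (p ^ t) ^ i * c ! (i mod length c)] (mod m)"
    by (simp add: mod_Suc_eq mult_ac)
  with Suc show ?case using cong_trans by blast
qed simp

text \<open>Elements of one cycle differ by units modulo \<open>m\<close>. The common gcd attaches
  the divisor \<open>m div gcd (c ! 0) m\<close> to the cycle.\<close>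

lemma gcd_cycle_nth:
  assumes "c \<in> set cs" "i < length c"
  shows "gcd (c ! i) m = gcd (c ! 0) m"
proof -
  have "gcd ((p ^ t) ^ i * c ! i) m = gcd (c ! 0) m"
    using cong_gcd_eq[OF cycle_nth_pow_cong[OF assms(1), of i]] assms(2) by simp
  moreover have "coprime m ((p ^ t) ^ i)" using coprime_pm by (simp add: coprime_commute)
  then have "gcd ((p ^ t) ^ i * c ! i) m = gcd (c ! i) m" by (rule gcd_mult_left_left_cancel)
  ultimately show ?thesis by simp
qed

text \<open>After \<open>k\<close> steps the cycle is at position \<open>k mod length c\<close>;
  cancelling the unit \<open>(p ^ t) ^ k\<close> turns the congruence into a return to the
  start.\<close>

lemma length_cycle_dvd:
  assumes c: "c \<in> set cs"
  shows "[(p ^ t) ^ k * c ! 0 = c ! 0] (mod m) \<longleftrightarrow> length c dvd k"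
proof -
  have L: "length c > 0" using cycle_decomposition_length_pos[OF cs c] .
  have k: "[(p ^ t) ^ k * c ! (k mod length c) = c ! 0] (mod m)" by (rule cycle_nth_pow_cong[OF c])
  have cop: "coprime ((p ^ t) ^ k) m" using coprime_pm by simp
  have "[(p ^ t) ^ k * c ! 0 = c ! 0] (mod m) \<longleftrightarrow>
      [(p ^ t) ^ k * c ! 0 = (p ^ t) ^ k * c ! (k mod length c)] (mod m)"
    using k cong_trans cong_sym by metis
  also have "\<dots> \<longleftrightarrow> [c ! 0 = c ! (k mod length c)] (mod m)"
    using cop by (rule cong_mult_lcancel_nat)
  also have "\<dots> \<longleftrightarrow> c ! 0 = c ! (k mod length c)"
    using cong_imp_eq_in_range cycle_nth_range[OF c] L by auto
  also have "\<dots> \<longleftrightarrow> k mod length c = 0"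
    using cycle_decomposition_unique[OF cs c L c, of "k mod length c"] L by auto
  finally show ?thesis by (simp add: dvd_eq_mod_eq_0)
qed

text \<open>With \<open>q = p^t\<close>, dividing \<open>q^k x = x\<close> modulo \<open>m\<close>
  by \<open>g = gcd(x, m)\<close> leaves \<open>q^k = 1\<close> modulo \<open>m / g\<close>, because
  \<open>x / g\<close> is a unit there.\<close>

lemma length_cycle_eq_ord:
  assumes c: "c \<in> set cs"
  shows "length c = Pocklington.ord (m div gcd (c ! 0) m) (p ^ t)"
proof -
  let ?q = "p ^ t"
  let ?g = "gcd (c ! 0) m"
  let ?d = "m div ?g"
  have L: "length c > 0" using cycle_decomposition_length_pos[OF cs c] .
  have g: "?g > 0" using m_pos by simp
  have md: "m = ?g * ?d" and cx: "c ! 0 = ?g * (c ! 0 div ?g)" by simp_all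
  have cop: "coprime (c ! 0 div ?g) ?d" using m_pos by (intro div_gcd_coprime) simp
  have "[?q ^ k = 1] (mod ?d) \<longleftrightarrow> length c dvd k" for k
  proof -
    have "[?q ^ k * c ! 0 = 1 * c ! 0] (mod m) \<longleftrightarrow>
        [?g * (?q ^ k * (c ! 0 div ?g)) = ?g * (1 * (c ! 0 div ?g))] (mod ?g * ?d)"
      by (simp add: mult.left_commute[of ?g] md[symmetric] cx[symmetric] del: mult_1)
    also have "\<dots> \<longleftrightarrow> [?q ^ k * (c ! 0 div ?g) = 1 * (c ! 0 div ?g)] (mod ?d)"
      using g unfolding cong_def mult_mod_right[symmetric] by (rule nat_mult_eq_cancel1)
    also have "\<dots> \<longleftrightarrow> [?q ^ k = 1] (mod ?d)"
      using cop by (rule cong_mult_rcancel_nat)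
    finally show ?thesis using length_cycle_dvd[OF c, of k] by simp
  qed
  then show ?thesis by (metis ord_divides dvd_antisym dvd_refl)
qed

text \<open>The cycles attached to \<open>d\<close> partition the \<open>totient d\<close> residues
  \<open>x\<close> with \<open>gcd(x, m) = m / d\<close>, and all have the same length.\<close>

lemma sum_length_cycles:
  assumes d: "d dvd m"
  shows "card {c \<in> set cs. m div gcd (c ! 0) m = d} * Pocklington.ord d (p ^ t) = totient d"
proof -
  let ?S = "{c \<in> set cs. m div gcd (c ! 0) m = d}"
  have dist: "distinct (concat cs)" using cs by (simp add: cycle_decomposition_def)
  have dg: "m div gcd x m = d \<longleftrightarrow> gcd x m = m div d" for x
  proof -
    obtain f where f: "m = d * f" using d by (elim dvdE)
    obtain e where e: "m = gcd x m * e" using gcd_dvd2[of x m] by (elim dvdE)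
    have pos: "d > 0" "e > 0" "f > 0" "gcd x m > 0" using f e m_pos by (auto intro: Nat.gr0I)
    have "m div gcd x m = e" using arg_cong[OF e, of "\<lambda>y. y div gcd x m"] pos by simp
    moreover have "m div d = f" using f pos by simp
    moreover have "e = d \<longleftrightarrow> G = f" if "G * e = d * f" for G
      using that pos by (auto simp: mult.commute)
    then have "e = d \<longleftrightarrow> gcd x m = f" using e f by metis
    ultimately show ?thesis by simp
  qed
  have "card ?S * Pocklington.ord d (p ^ t) = (\<Sum>c\<in>?S. length c)"
    using length_cycle_eq_ord by simp
  also have "\<dots> = (\<Sum>c\<in>?S. card (set c))"
    using dist by (intro sum.cong) (auto simp: distinct_concat_iff distinct_card)
  also have "\<dots> = card (\<Union>c\<in>?S. set c)"
    using dist by (intro card_UN_disjoint[symmetric]) (auto simp: distinct_concat_iff)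
  also have "(\<Union>c\<in>?S. set c) = {x \<in> {0<..m}. gcd x m = m div d}"
  proof (intro equalityI subsetI)
    fix x assume "x \<in> (\<Union>c\<in>?S. set c)"
    then obtain c i where "c \<in> set cs" "m div gcd (c ! 0) m = d" "i < length c" "x = c ! i"
      by (auto simp: in_set_conv_nth)
    then show "x \<in> {x \<in> {0<..m}. gcd x m = m div d}"
      using cycle_nth_range[of c i] gcd_cycle_nth[of c i] dg by auto
  next
    fix x assume x: "x \<in> {x \<in> {0<..m}. gcd x m = m div d}"
    then have "x \<in> {1..m}" by auto
    then obtain c i where c: "c \<in> set cs" "i < length c" "x = c ! i"
      using cycle_decomposition_cover[OF cs] by blast
    then have "c \<in> ?S" using x gcd_cycle_nth[of c i] dg by auto
    then show "x \<in> (\<Union>c\<in>?S. set c)" using c by auto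
  qed
  also have "card \<dots> = totient (m div (m div d))"
    using d m_pos by (intro card_gcd_eq_totient) (auto simp: div_dvd_iff_mult)
  also have "m div (m div d) = d" using d m_pos by (auto elim!: dvdE)
  finally show ?thesis .
qed

lemma prod_over_cycles:
  fixes g :: "nat \<Rightarrow> nat"
  shows "(\<Prod>c\<in>set cs. g (length c)) =
    (\<Prod>d | d dvd m. g (Pocklington.ord d (p ^ t)) ^ (totient d div Pocklington.ord d (p ^ t)))"
proof -
  let ?D = "\<lambda>c. m div gcd (c ! 0) m"
  have fin: "finite {d. d dvd m}" using m_pos by simp
  have dv: "m div gcd x m dvd m" for x by (metis dvd_div_mult_self dvd_triv_left gcd_dvd2)
  have "(\<Prod>c\<in>set cs. g (length c)) = (\<Prod>d | d dvd m. \<Prod>c\<in>{c \<in> set cs. ?D c = d}. g (length c))"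
    using fin dv by (intro prod.group[symmetric]) auto
  also have "\<dots> = (\<Prod>d | d dvd m. g (Pocklington.ord d (p ^ t)) ^ (totient d div Pocklington.ord d (p ^ t)))"
  proof (rule prod.cong)
    fix d assume "d \<in> {d. d dvd m}"
    then have d: "d dvd m" by simp
    have "coprime m (p ^ t)" using coprime_pm by (simp add: coprime_commute)
    then have "coprime d (p ^ t)" using d by (rule coprime_divisors[OF _ dvd_refl, rotated])
    then have "Pocklington.ord d (p ^ t) > 0" by simp
    then have "card {c \<in> set cs. ?D c = d} = totient d div Pocklington.ord d (p ^ t)"
      using sum_length_cycles[OF d] by (metis div_mult_self_is_m)
    moreover have "(\<Prod>c\<in>{c \<in> set cs. ?D c = d}. g (length c)) =
        (\<Prod>c\<in>{c \<in> set cs. ?D c = d}. g (Pocklington.ord d (p ^ t)))"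
      using length_cycle_eq_ord by (intro prod.cong) auto
    ultimately show "(\<Prod>c\<in>{c \<in> set cs. ?D c = d}. g (length c)) =
      g (Pocklington.ord d (p ^ t)) ^ (totient d div Pocklington.ord d (p ^ t))" by simp
  qed simp
  finally show ?thesis .
qed

text \<open>The permutation inverts multiplication by \<open>q\<close> while the Frobenius map raises roots of unity
  to the power \<open>q\<close>, so every cycle has to be traversed backwards.\<close>

lemma exists_root_labelling:
  fixes w :: "'a::field"
  assumes w: "\<And>e. w ^ e = 1 \<longleftrightarrow> m dvd e"
  shows "\<exists>Z :: nat \<Rightarrow> 'a. inj_on Z {1..m} \<and> (\<forall>x\<in>{1..m}. Z x ^ m = 1 \<and> Z (sigma p t m x) = Z x ^ (p ^ t))"
proof -
  have w0: "w \<noteq> 0" using w[of m] m_pos by (auto simp: power_0_left)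
  have wcong: "w ^ a = w ^ b \<longleftrightarrow> [a = b] (mod m)" for a b
  proof (induction a b rule: linorder_wlog)
    case (le a b)
    have "w ^ b = w ^ a * w ^ (b - a)" using le by (simp flip: power_add)
    then have "w ^ a = w ^ b \<longleftrightarrow> w ^ (b - a) = 1" using w0 by auto
    then show ?case using w cong_altdef_nat[OF le] by (simp add: cong_sym_eq)
  next
    case (sym a b)
    then show ?case by (auto simp: cong_sym_eq)
  qed
  \<comment> \<open>Position \<open>i\<close> goes to \<open>-i\<close> modulo the length. With
    \<open>Z x = w ^ P x\<close>, a step of \<open>sigma\<close> becomes a backward step in the
    exponent, which is multiplication by \<open>p ^ t\<close>.\<close>
  obtain P where P: "\<And>c i. c \<in> set cs \<Longrightarrow> i < length c \<Longrightarrow> P (c ! i) = c ! ((length c - i) mod length c)"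
    using cycle_decomposition_define[OF cs, of "\<lambda>c i. c ! ((length c - i) mod length c)"] by blast
  define Z where "Z x = w ^ P x" for x
  have lt: "(length c - i) mod length c < length c" if "i < length c" for c :: "nat list" and i
    by (rule mod_less_divisor) (use that in linarith)
  have inv: "i = j" if "(L - i) mod L = (L - j) mod L" "i < L" "j < L" for i j L :: nat
    using that by (cases "i = 0"; cases "j = 0") auto
  have "inj_on Z {1..m}"
  proof (rule inj_onI)
    fix x y assume xy: "x \<in> {1..m}" "y \<in> {1..m}" "Z x = Z y"
    obtain c i where c: "c \<in> set cs" "i < length c" "x = c ! i"
      using xy cycle_decomposition_cover[OF cs] by blast
    obtain d j where d: "d \<in> set cs" "j < length d" "y = d ! j"
      using xy cycle_decomposition_cover[OF cs] by blast
    have "[P x = P y] (mod m)" using xy wcong by (simp add: Z_def)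
    then have "P x = P y"
      using P c d lt cycle_nth_range by (intro cong_imp_eq_in_range) auto
    then have "c ! ((length c - i) mod length c) = d ! ((length d - j) mod length d)"
      using P c d by simp
    from cycle_decomposition_unique[OF cs c(1) lt[OF c(2)] d(1) lt[OF d(2)] this]
    have cd: "c = d" "(length c - i) mod length c = (length c - j) mod length c" by auto
    have "i = j" using cd(2) c(2) d(2)[folded cd(1)] by (rule inv)
    then show "x = y" using cd(1) c(3) d(3) by simp
  qed
  moreover have "Z x ^ m = 1 \<and> Z (sigma p t m x) = Z x ^ (p ^ t)" if x: "x \<in> {1..m}" for x
  proof
    show "Z x ^ m = 1" using w by (simp add: Z_def flip: power_mult)
    obtain c i where c: "c \<in> set cs" "i < length c" "x = c ! i"
      using x cycle_decomposition_cover[OF cs] by blast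
    define L where "L = length c"
    \<comment> \<open>\<open>k\<close> is \<open>-(i + 1)\<close> modulo \<open>L\<close>, the
      position of \<open>P (sigma p t m x)\<close>; \<open>Suc k\<close> gives that of
      \<open>P x\<close>.\<close>
    define k where "k = (L - Suc i mod L) mod L"
    have L: "L > 0" "i < L" using c by (auto simp: L_def)
    have k: "k < L" using L by (simp add: k_def)
    have "Suc k mod L = (L - i) mod L"
    proof (cases "Suc i = L")
      case True
      then show ?thesis by (auto simp: k_def)
    next
      case False
      then have "k = L - Suc i" using L by (simp add: k_def)
      then show ?thesis using L by (simp add: Suc_diff_Suc)
    qed
    then have Px: "P x = c ! (Suc k mod L)" using P c by (simp add: L_def)
    have "sigma p t m x = c ! (Suc i mod L)"
      using cycle_decomposition_nth[OF cs c(1,2)] c(3) by (simp add: L_def)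
    then have Ps: "P (sigma p t m x) = c ! k"
      using P[OF c(1), of "Suc i mod L"] L by (simp add: L_def k_def)
    have "[p ^ t * P x = P (sigma p t m x)] (mod m)"
      unfolding Px Ps using cycle_nth_cong[OF c(1), of k] k by (simp add: L_def)
    then have "w ^ (p ^ t * P x) = w ^ P (sigma p t m x)" using wcong by blast
    then show "Z (sigma p t m x) = Z x ^ (p ^ t)" by (simp add: Z_def mult.commute flip: power_mult)
  qed
  ultimately show ?thesis by (intro exI[of _ Z]) simp
qed

end

section \<open>Rational circulant matrices\<close>

lemma frob_0: "frob p 0 w = w"
  by (rule eq_vecI) (simp_all add: frob_def)

lemma frob_frob: "frob p a (frob p b w) = frob p (a + b) w"
  by (rule eq_vecI) (simp_all add: frob_def power_mult[symmetric] power_add mult.commute)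

lemma frob_carrier [simp]: "frob p u w \<in> carrier_vec N \<longleftrightarrow> w \<in> carrier_vec N"
  unfolding frob_def carrier_vec_def mem_Collect_eq index_map_vec ..

lemma coord_frob:
  assumes "l > 0" "p > 0"
  shows "coord (frob p u w) l = coord w l ^ (p ^ u)"
  using assms by (auto simp: coord_def frob_def power_0_left)

lemma frob_eq_self_iff: "frob p u w = w \<longleftrightarrow> set\<^sub>v w \<subseteq> {x. x ^ (p ^ u) = x}"
  by (auto simp: vec_eq_iff frob_def vec_set_def)

text \<open>Raising to a power of the characteristic is a ring homomorphism, hence compatible with
  substituting \<open>x + z\<close>.\<close>

lemma taylor_vec_frobenius:
  assumes "Factorial_Ring.prime CHAR('a::field)"
  shows "taylor_vec N ((z::'a) ^ (CHAR('a) ^ u)) (map_poly (\<lambda>x. x ^ (CHAR('a) ^ u)) f) =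
    frob CHAR('a) u (taylor_vec N z f)"
proof -
  interpret field_hom "\<lambda>x::'a. x ^ (CHAR('a) ^ u)" using assms by (rule frobenius_field_hom) simp
  show ?thesis
    using taylor_coeff_hom[OF comm_ring_hom_axioms, of z f]
    by (intro eq_vecI) (simp_all add: taylor_vec_def frob_def)
qed

lemma (in field_hom) CHAR_eq:
  "CHAR('a) = CHAR('b)"
proof (rule sym, rule CHAR_eqI)
  show "of_nat CHAR('a) = (0::'b)" using hom_of_nat[of "CHAR('a)"] by simp
next
  fix k assume "of_nat k = (0::'b)"
  then have "hom (of_nat k) = 0" by (simp add: hom_of_nat)
  then show "CHAR('a) dvd k" by (simp add: of_nat_eq_0_iff_char_dvd)
qed

text \<open>With \<open>card S = Q\<close>, this is the factor that a single cycle contributes to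
  the order.\<close>

lemma card_vecs_last_nonzero:
  fixes S :: "'a::field set"
  assumes "finite S" "0 \<in> S" "N > 0"
  shows "card {w \<in> carrier_vec N. set\<^sub>v w \<subseteq> S \<and> coord w N \<noteq> 0} = (card S - 1) * card S ^ (N - 1)"
proof -
  let ?T = "\<lambda>i. if i = N - 1 then S - {0} else S"
  have "bij_betw (vec N) (PiE {..<N} ?T) {w \<in> carrier_vec N. set\<^sub>v w \<subseteq> S \<and> coord w N \<noteq> 0}"
  proof (rule bij_betw_imageI)
    show "inj_on (vec N) (PiE {..<N} ?T)"
    proof (rule inj_onI)
      fix u v assume uv: "u \<in> PiE {..<N} ?T" "v \<in> PiE {..<N} ?T" "vec N u = vec N v"
      have "u i = v i" if "i \<in> {..<N}" for i using uv(3) that by (metis index_vec lessThan_iff)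
      then show "u = v" using uv by (intro PiE_ext)
    qed
    show "vec N ` PiE {..<N} ?T = {w \<in> carrier_vec N. set\<^sub>v w \<subseteq> S \<and> coord w N \<noteq> 0}"
    proof (intro equalityI subsetI)
      fix w assume "w \<in> vec N ` PiE {..<N} ?T"
      then obtain u where u: "u \<in> PiE {..<N} ?T" "w = vec N u" by blast
      have "u i \<in> S" if "i < N" for i using PiE_mem[OF u(1), of i] that by (auto split: if_splits)
      moreover have "u (N - 1) \<noteq> 0" using PiE_mem[OF u(1), of "N - 1"] assms(3) by auto
      ultimately show "w \<in> {w \<in> carrier_vec N. set\<^sub>v w \<subseteq> S \<and> coord w N \<noteq> 0}"
        using u(2) assms(3) by (auto simp: vec_set_def coord_def)
    next
      fix w assume "w \<in> {w \<in> carrier_vec N. set\<^sub>v w \<subseteq> S \<and> coord w N \<noteq> 0}"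
      then have w: "w \<in> carrier_vec N" "set\<^sub>v w \<subseteq> S" "w $ (N - 1) \<noteq> 0" by (auto simp: coord_def)
      have "w $ i \<in> S" if "i < N" for i using w(1,2) that by (auto simp: vec_set_def)
      then have "restrict (\<lambda>i. w $ i) {..<N} \<in> PiE {..<N} ?T" using w(3) by auto
      moreover have "w = vec N (restrict (\<lambda>i. w $ i) {..<N})" using w(1) by (intro eq_vecI) auto
      ultimately show "w \<in> vec N ` PiE {..<N} ?T" by blast
    qed
  qed
  then have "card {w \<in> carrier_vec N. set\<^sub>v w \<subseteq> S \<and> coord w N \<noteq> 0} = (\<Prod>i<N. card (?T i))"
    by (simp add: bij_betw_same_card[symmetric] card_PiE)
  also obtain M where M: "N = Suc M" using assms(3) by (cases N) auto
  have "(\<Prod>i<N. card (?T i)) = (\<Prod>i<M. card S) * card (S - {0})"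
    unfolding M by simp
  also have "\<dots> = (card S - 1) * card S ^ (N - 1)"
    using assms M by (simp add: card_Diff_singleton)
  finally show ?thesis .
qed

text \<open>The matrices live over \<open>'k\<close>, their spectrum over \<open>'a\<close>. As
  \<open>'a\<close> may be infinite, both the algebraic closure used for (i) and the field of (ii)
  are instances.\<close>

locale circulant_frobenius =
  frobenius_cycles p t m cs + circulant_spectrum m N n Z + hom: field_hom \<iota>
  for p t m :: nat and cs and N n :: nat and Z :: "nat \<Rightarrow> 'a::field" and \<iota> :: "'k::field \<Rightarrow> 'a" +
  assumes prime_p: "Factorial_Ring.prime p" and t_pos: "t > 0"
    and card_k: "card (UNIV :: 'k set) = p ^ t"
    and Z_sigma: "\<And>x. x \<in> {1..m} \<Longrightarrow> Z (sigma p t m x) = Z x ^ (p ^ t)"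
begin

lemma CHAR_a: "CHAR('a) = p"
  using CHAR_eq_if_card_UNIV[OF prime_p card_k] hom.CHAR_eq by simp

lemma q_gt_1: "p ^ t > 1"
  using prime_gt_1_nat[OF prime_p] t_pos by (rule one_less_power)

lemma iota_power: "\<iota> y ^ (p ^ t) = \<iota> y"
proof -
  have "card (UNIV :: 'k set) > 0" using card_k prime_gt_0_nat[OF prime_p] by simp
  then have "finite (UNIV :: 'k set)" by (rule card_ge_0_finite)
  then have "y ^ card (UNIV :: 'k set) = y" by (intro power_card_eq_self) simp_all
  then show ?thesis by (metis card_k hom.hom_power)
qed

text \<open>The image consists of \<open>p ^ t\<close> solutions of an equation that has at most
  that many.\<close>

lemma range_iota: "range \<iota> = {x. x ^ (p ^ t) = x}"
proof (rule card_seteq)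
  show "finite {x::'a. x ^ (p ^ t) = x}" using card_frobenius_fixed_le[OF q_gt_1] by blast
  show "range \<iota> \<subseteq> {x. x ^ (p ^ t) = x}" using iota_power by auto
  have "card (range \<iota>) = p ^ t" using hom.injectivity card_k by (simp add: card_image inj_def)
  then show "card {x::'a. x ^ (p ^ t) = x} \<le> card (range \<iota>)"
    using card_frobenius_fixed_le(2)[OF q_gt_1] by simp
qed

lemma taylor_vec_Z_sigma:
  assumes "x \<in> {1..m}"
  shows "taylor_vec N (Z (sigma p t m x)) (map_poly (\<lambda>x. x ^ (p ^ t)) f) = frob p t (taylor_vec N (Z x) f)"
  unfolding Z_sigma[OF assms] using taylor_vec_frobenius[of N "Z x" t f] CHAR_a prime_p by simp

lemma eq_if_taylor_vec_eq:
  assumes "degree f < n" "degree g < n" "\<And>x. x \<in> {1..m} \<Longrightarrow> taylor_vec N (Z x) f = taylor_vec N (Z x) g"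
  shows "f = g"
proof (rule eq_if_taylor_eq[OF assms(1,2)])
  fix x e assume "x \<in> {1..m}" "e < N"
  then show "taylor_coeff (Z x) f e = taylor_coeff (Z x) g e"
    using assms(3) taylor_vec_index[of e N] by metis
qed

text \<open>By \<open>range_iota\<close>, rationality means that raising all coefficients to the
  power \<open>p ^ t\<close> fixes \<open>f\<close>. The expansion of the new polynomial at
  \<open>Z (sigma p t m x)\<close> is the Frobenius image of that of \<open>f\<close> at
  \<open>Z x\<close>, and \<open>sigma\<close> reaches every label, so comparing expansions
  decides.\<close>

lemma rational_poly_iff:
  assumes f: "degree f < n"
  shows "f \<in> range (map_poly \<iota>) \<longleftrightarrow>
    (\<forall>x\<in>{1..m}. taylor_vec N (Z (sigma p t m x)) f = frob p t (taylor_vec N (Z x) f))"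
proof -
  let ?F = "map_poly (\<lambda>x. x ^ (p ^ t))"
  have pos: "p ^ t > 0" using prime_gt_0_nat[OF prime_p] by simp
  have coeff_F: "coeff (?F f) i = coeff f i ^ (p ^ t)" for i
    using pos by (simp add: coeff_map_poly)
  have "f \<in> range (map_poly \<iota>) \<longleftrightarrow> (\<forall>i. coeff f i \<in> range \<iota>)"
  proof
    assume *: "\<forall>i. coeff f i \<in> range \<iota>"
    have "f = map_poly \<iota> (map_poly (inv_into UNIV \<iota>) f)"
    proof (rule poly_eqI)
      fix i
      have "inv_into UNIV \<iota> 0 = 0"
        using inv_into_f_f[of \<iota> UNIV 0] hom.injectivity by (simp add: inj_def)
      then show "coeff f i = coeff (map_poly \<iota> (map_poly (inv_into UNIV \<iota>) f)) i"
        using * by (simp add: coeff_map_poly f_inv_into_f)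
    qed
    then show "f \<in> range (map_poly \<iota>)" by blast
  qed (auto simp: coeff_map_poly)
  also have "\<dots> \<longleftrightarrow> ?F f = f"
    unfolding range_iota poly_eq_iff coeff_F by simp
  also have "\<dots> \<longleftrightarrow> (\<forall>x\<in>{1..m}. taylor_vec N (Z (sigma p t m x)) f = frob p t (taylor_vec N (Z x) f))"
  proof
    assume "?F f = f"
    then show "\<forall>x\<in>{1..m}. taylor_vec N (Z (sigma p t m x)) f = frob p t (taylor_vec N (Z x) f)"
      using taylor_vec_Z_sigma[of _ f] by simp
  next
    assume *: "\<forall>x\<in>{1..m}. taylor_vec N (Z (sigma p t m x)) f = frob p t (taylor_vec N (Z x) f)"
    show "?F f = f"
    proof (rule eq_if_taylor_vec_eq[OF _ f])
      show "degree (?F f) < n" using f map_poly_degree_leq[of "\<lambda>x. x ^ (p ^ t)" f] by simp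
      fix y assume y: "y \<in> {1..m}"
      have "sigma p t m ` {1..m} = {1..m}"
        using sigma_permutes[OF coprime_pm m_pos] by (rule permutes_image)
      then obtain x where x: "x \<in> {1..m}" "y = sigma p t m x" using y by blast
      show "taylor_vec N (Z y) (?F f) = taylor_vec N (Z y) f"
        using taylor_vec_Z_sigma[OF x(1), of f] * x by simp
    qed
  qed
  finally show ?thesis .
qed

text \<open>The conditions of (ii) without cycles: one step of \<open>sigma\<close> is one Frobenius
  step, the form in which Taylor data satisfy them.\<close>

definition admissible :: "(nat \<Rightarrow> 'a vec) \<Rightarrow> bool" where
  "admissible v \<longleftrightarrow> (\<forall>x\<in>{1..m}. v x \<in> carrier_vec N \<and> coord (v x) N \<noteq> 0 \<and>
     v (sigma p t m x) = frob p t (v x))"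

definition taylor_family :: "'k poly \<Rightarrow> nat \<Rightarrow> 'a vec" where
  "taylor_family g x = taylor_vec N (Z x) (map_poly \<iota> g)"

lemma sigma_range: "x \<in> {1..m} \<Longrightarrow> sigma p t m x \<in> {1..m}"
  using sigma_cong(1)[OF coprime_pm m_pos] .

lemma admissible_cong:
  assumes "\<And>x. x \<in> {1..m} \<Longrightarrow> u x = v x"
  shows "admissible u \<longleftrightarrow> admissible v"
  using assms sigma_range by (simp add: admissible_def)

text \<open>Once round a cycle of length \<open>L\<close> applies the \<open>p ^ t\<close> power map
  \<open>L\<close> times, so the entries of the start vector are fixed by it. Conversely, this makes
  the step from the end of the cycle back to its start consistent.\<close>

lemma admissible_iff_cycles:
  "admissible v \<longleftrightarrow>
    (\<forall>x\<in>{1..m}. v x \<in> carrier_vec N \<and> coord (v x) N \<noteq> 0) \<and>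
    (\<forall>c\<in>set cs. set\<^sub>v (v (c ! 0)) \<subseteq> {x. x ^ (p ^ (t * length c)) = x} \<and>
       (\<forall>i\<in>{1..<length c}. v (c ! i) = frob p (i * t) (v (c ! 0))))"
proof -
  have "(\<forall>x\<in>{1..m}. v (sigma p t m x) = frob p t (v x)) \<longleftrightarrow>
    (\<forall>c\<in>set cs. set\<^sub>v (v (c ! 0)) \<subseteq> {x. x ^ (p ^ (t * length c)) = x} \<and>
       (\<forall>i\<in>{1..<length c}. v (c ! i) = frob p (i * t) (v (c ! 0))))" (is "?A \<longleftrightarrow> ?B")
  proof
    assume A: ?A
    show ?B
    proof
      fix c assume c: "c \<in> set cs"
      have L: "length c > 0" using cycle_decomposition_length_pos[OF cs c] .
      have step: "v (c ! (Suc i mod length c)) = frob p t (v (c ! i))" if "i < length c" for i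
        using A cycle_nth_range[OF c that] cycle_decomposition_nth[OF cs c that] by metis
      have pow: "i < length c \<Longrightarrow> v (c ! i) = frob p (i * t) (v (c ! 0))" for i
      proof (induction i)
        case (Suc i)
        then show ?case using step[of i] by (simp add: frob_frob)
      qed (simp add: frob_0)
      have "Suc (length c - 1) = length c" using L by simp
      then have "v (c ! 0) = frob p t (v (c ! (length c - 1)))" using step[of "length c - 1"] L by simp
      also have "\<dots> = frob p (t + (length c - 1) * t) (v (c ! 0))"
        using pow[of "length c - 1"] L by (simp add: frob_frob)
      also have "t + (length c - 1) * t = t * length c" using L by (cases c) (simp_all add: mult.commute)
      finally have "frob p (t * length c) (v (c ! 0)) = v (c ! 0)" by simp
      then show "set\<^sub>v (v (c ! 0)) \<subseteq> {x. x ^ (p ^ (t * length c)) = x} \<and>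
        (\<forall>i\<in>{1..<length c}. v (c ! i) = frob p (i * t) (v (c ! 0)))"
        using pow unfolding frob_eq_self_iff by simp
    qed
  next
    assume B: ?B
    show ?A
    proof
      fix x assume "x \<in> {1..m}"
      then obtain c i where c: "c \<in> set cs" "i < length c" "x = c ! i"
        using cycle_decomposition_cover[OF cs] by blast
      have pow: "v (c ! j) = frob p (j * t) (v (c ! 0))" if "j < length c" for j
        using B c(1) that by (cases "j = 0") (auto simp: frob_0)
      have "sigma p t m x = c ! (Suc i mod length c)"
        using cycle_decomposition_nth[OF cs c(1,2)] c(3) by simp
      moreover have "v (c ! (Suc i mod length c)) = frob p (t + i * t) (v (c ! 0))"
      proof (cases "Suc i = length c")
        case True
        have "t + i * t = t * length c" unfolding True[symmetric] by (simp add: mult.commute)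
        moreover have "frob p (t * length c) (v (c ! 0)) = v (c ! 0)"
          using B c(1) unfolding frob_eq_self_iff by blast
        ultimately show ?thesis using True by simp
      next
        case False
        then show ?thesis using pow[of "Suc i"] c(2) by simp
      qed
      ultimately show "v (sigma p t m x) = frob p t (v x)"
        using pow[OF c(2)] c(3) by (simp add: frob_frob)
    qed
  qed
  then show ?thesis unfolding admissible_def by blast
qed

lemma admissible_taylor_family_iff:
  assumes "degree g < n"
  shows "admissible (taylor_family g) \<longleftrightarrow> (\<forall>x\<in>{1..m}. poly (map_poly \<iota> g) (Z x) \<noteq> 0)"
proof -
  have "map_poly \<iota> g \<in> range (map_poly \<iota>)" by blast
  then have "\<forall>x\<in>{1..m}. taylor_family g (sigma p t m x) = frob p t (taylor_family g x)"
    using rational_poly_iff[of "map_poly \<iota> g"] assms unfolding taylor_family_def by simp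
  then show ?thesis
    using N_pos by (simp add: admissible_def taylor_family_def coord_taylor_vec)
qed

text \<open>Interpolation over \<open>'a\<close> yields a polynomial, and the Frobenius condition
  brings it down to \<open>'k\<close>.\<close>

lemma admissible_imp_taylor_family:
  assumes v: "admissible v"
  shows "\<exists>g. degree g < n \<and> (\<forall>x\<in>{1..m}. v x = taylor_family g x)"
proof -
  obtain f where f: "degree f < n" "\<And>i e. i \<in> {1..m} \<Longrightarrow> e < N \<Longrightarrow> taylor_coeff (Z i) f e = v i $ (N - 1 - e)"
    using exists_taylor[of "\<lambda>i e. v i $ (N - 1 - e)"] by blast
  have vf: "v x = taylor_vec N (Z x) f" if x: "x \<in> {1..m}" for x
  proof (rule eq_vecI)
    have d: "dim_vec (v x) = N" using v x by (auto simp: admissible_def)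
    then show "dim_vec (v x) = dim_vec (taylor_vec N (Z x) f)" by (simp add: taylor_vec_def)
    fix l assume "l < dim_vec (taylor_vec N (Z x) f)"
    then have l: "l < N" by (simp add: taylor_vec_def)
    then have "N - 1 - (N - 1 - l) = l" "N - 1 - l < N" by linarith+
    then show "v x $ l = taylor_vec N (Z x) f $ l"
      using f(2)[OF x, of "N - 1 - l"] l by (simp add: taylor_vec_def)
  qed
  then have "\<forall>x\<in>{1..m}. taylor_vec N (Z (sigma p t m x)) f = frob p t (taylor_vec N (Z x) f)"
    using v sigma_range unfolding admissible_def by metis
  then obtain g where g: "f = map_poly \<iota> g" using rational_poly_iff[OF f(1)] by blast
  then show ?thesis using f(1) vf by (intro exI[of _ g]) (simp add: taylor_family_def)
qed

lemma taylor_family_inject: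
  assumes "degree g < n" "degree h < n" "\<And>x. x \<in> {1..m} \<Longrightarrow> taylor_family g x = taylor_family h x"
  shows "g = h"
proof -
  have "map_poly \<iota> g = map_poly \<iota> h"
    using assms by (intro eq_if_taylor_vec_eq) (simp_all add: taylor_family_def)
  then show ?thesis by (simp add: poly_eq_iff coeff_map_poly)
qed

lemma map_mat_circ: "map_mat \<iota> (circ n g) = circ n (map_poly \<iota> g)"
  by (rule eq_matI) (auto simp: circ_def coeff_map_poly)

text \<open>An embedding preserves and reflects the vanishing of determinants, so regularity over
  \<open>'k\<close> can be tested at the roots in \<open>'a\<close>.\<close>

lemma carrier_RC_eq:
  "carrier (RC n :: 'k mat monoid) = circ n ` {g. degree g < n \<and> admissible (taylor_family g)}"
proof -
  have *: "det (circ n g) \<noteq> 0 \<longleftrightarrow> admissible (taylor_family g)" if "degree g < n" for g :: "'k poly"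
  proof -
    have "det (circ n g) = 0 \<longleftrightarrow> det (map_mat \<iota> (circ n g)) = 0" by simp
    also have "\<dots> \<longleftrightarrow> (\<exists>i\<in>{1..m}. poly (map_poly \<iota> g) (Z i) = 0)"
      unfolding map_mat_circ using that by (intro det_circ_eq_0_iff) simp
    finally show ?thesis using admissible_taylor_family_iff[OF that] by simp
  qed
  show ?thesis
  proof (intro equalityI subsetI)
    fix A :: "'k mat" assume "A \<in> carrier (RC n)"
    then have "circulant n A" "det A \<noteq> 0" by (auto simp: carrier_RC)
    then show "A \<in> circ n ` {g. degree g < n \<and> admissible (taylor_family g)}"
      using circulant_imp_circ[OF n_pos, of A] * by blast
  next
    fix A :: "'k mat" assume "A \<in> circ n ` {g. degree g < n \<and> admissible (taylor_family g)}"
    then show "A \<in> carrier (RC n)" using * circulant_circ by (auto simp: carrier_RC)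
  qed
qed

text \<open>A regular circulant amounts to one freely chosen vector per cycle, with entries in a
  Frobenius fixed set and nonzero last coordinate. The assumption \<open>fixed\<close> says that
  \<open>'a\<close> contains these sets in full size.\<close>

lemma card_RC:
  assumes fixed: "\<And>c. c \<in> set cs \<Longrightarrow> card {x::'a. x ^ (p ^ (t * length c)) = x} = p ^ (t * length c)"
  shows "card (carrier (RC n :: 'k mat monoid)) =
    (\<Prod>c\<in>set cs. (p ^ (t * length c) - 1) * (p ^ (t * length c)) ^ (N - 1))"
proof -
  let ?A = "{g. degree g < n \<and> admissible (taylor_family g)}"
  let ?W = "\<lambda>c. {w \<in> carrier_vec N. set\<^sub>v w \<subseteq> {x::'a. x ^ (p ^ (t * length c)) = x} \<and> coord w N \<noteq> 0}"
  let ?\<Phi> = "\<lambda>g. restrict (\<lambda>c. taylor_family g (c ! 0)) (set cs)"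
  have range0: "c ! 0 \<in> {1..m}" if "c \<in> set cs" for c
    using cycle_nth_range that cycle_decomposition_length_pos[OF cs] by blast
  have "bij_betw ?\<Phi> ?A (PiE (set cs) ?W)"
  proof (rule bij_betw_imageI)
    show "inj_on ?\<Phi> ?A"
    proof (rule inj_onI)
      fix g h assume g: "g \<in> ?A" and h: "h \<in> ?A" and eq: "?\<Phi> g = ?\<Phi> h"
      have "taylor_family g x = taylor_family h x" if x: "x \<in> {1..m}" for x
      proof -
        obtain c i where c: "c \<in> set cs" "i < length c" "x = c ! i"
          using x cycle_decomposition_cover[OF cs] by blast
        have 0: "taylor_family g (c ! 0) = taylor_family h (c ! 0)"
          using fun_cong[OF eq, of c] c(1) by simp
        show ?thesis
        proof (cases "i = 0")
          case False
          then have "i \<in> {1..<length c}" using c(2) by simp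
          then show ?thesis using g h c 0 unfolding mem_Collect_eq admissible_iff_cycles by metis
        qed (use 0 c in simp)
      qed
      then show "g = h" using g h by (intro taylor_family_inject) auto
    qed
    show "?\<Phi> ` ?A = PiE (set cs) ?W"
    proof (intro equalityI subsetI)
      fix u assume "u \<in> ?\<Phi> ` ?A"
      then obtain g where g: "g \<in> ?A" "u = ?\<Phi> g" by blast
      show "u \<in> PiE (set cs) ?W"
        unfolding g(2) using g(1) range0 by (auto simp: admissible_iff_cycles)
    next
      fix u assume u: "u \<in> PiE (set cs) ?W"
      \<comment> \<open>The choice at the start of each cycle is spread along it by
        Frobenius.\<close>
      obtain v where v: "\<And>c i. c \<in> set cs \<Longrightarrow> i < length c \<Longrightarrow> v (c ! i) = frob p (i * t) (u c)"
        using cycle_decomposition_define[OF cs, of "\<lambda>c i. frob p (i * t) (u c)"] by blast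
      have v0: "v (c ! 0) = u c" if "c \<in> set cs" for c
        using v[OF that, of 0] cycle_decomposition_length_pos[OF cs that] by (simp add: frob_0)
      have W: "u c \<in> ?W c" if "c \<in> set cs" for c using u that by (rule PiE_mem)
      have "admissible v"
        unfolding admissible_iff_cycles
      proof (intro conjI ballI)
        fix x assume "x \<in> {1..m}"
        then obtain c i where c: "c \<in> set cs" "i < length c" "x = c ! i"
          using cycle_decomposition_cover[OF cs] by blast
        show "v x \<in> carrier_vec N" using v[OF c(1,2)] W[OF c(1)] c(3) by simp
        show "coord (v x) N \<noteq> 0"
          using v[OF c(1,2)] W[OF c(1)] c(3) coord_frob[of N p "i * t" "u c"] N_pos prime_gt_0_nat[OF prime_p]
          by simp
      qed (use v v0 W in auto)
      then obtain g where g: "degree g < n" "\<And>x. x \<in> {1..m} \<Longrightarrow> v x = taylor_family g x"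
        using admissible_imp_taylor_family by blast
      have "g \<in> ?A" using g admissible_cong[of v "taylor_family g"] \<open>admissible v\<close> by simp
      moreover have "restrict u (set cs) = ?\<Phi> g"
        using g(2) v0 range0 by (intro restrict_ext) simp
      then have "u = ?\<Phi> g" using PiE_restrict[OF u] by simp
      ultimately show "u \<in> ?\<Phi> ` ?A" by blast
    qed
  qed
  then have "card ?A = card (PiE (set cs) ?W)" by (rule bij_betw_same_card)
  also have "\<dots> = (\<Prod>c\<in>set cs. card (?W c))" by (simp add: card_PiE)
  also have "\<dots> = (\<Prod>c\<in>set cs. (p ^ (t * length c) - 1) * (p ^ (t * length c)) ^ (N - 1))"
  proof (rule prod.cong)
    fix c assume c: "c \<in> set cs"
    have pos: "p ^ (t * length c) > 0" using prime_gt_0_nat[OF prime_p] by simp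
    then have "finite {x::'a. x ^ (p ^ (t * length c)) = x}" using fixed[OF c] by (metis card_ge_0_finite)
    then show "card (?W c) = (p ^ (t * length c) - 1) * (p ^ (t * length c)) ^ (N - 1)"
      using card_vecs_last_nonzero[of "{x::'a. x ^ (p ^ (t * length c)) = x}" N] N_pos pos fixed[OF c]
      by (simp add: power_0_left)
  qed simp
  also have "card ?A = card (carrier (RC n :: 'k mat monoid))"
    unfolding carrier_RC_eq using circ_inject by (intro card_image[symmetric] inj_onI) auto
  finally show ?thesis .
qed

text \<open>\<open>taylor_mat\<close> takes each embedded circulant to its block matrix, and
  interpolation shows that every admissible family is reached. The block matrices form a subgroup
  because they are a conjugate of one.\<close>

lemma conjugate_toeplitz_blocks:
  "conjugate_subgroups (GL n) (map_mat \<iota> ` carrier (RC n :: 'k mat monoid))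
     {toeplitz_blocks m v | v. admissible v}"
proof -
  let ?H = "map_mat \<iota> ` carrier (RC n :: 'k mat monoid)"
  let ?K = "{toeplitz_blocks m v | v. admissible v}"
  interpret G: Group.group "GL n :: 'a mat monoid" by (rule group_GL)
  have "group_hom (GL n :: 'k mat monoid) (GL n :: 'a mat monoid) (map_mat \<iota>)"
  proof (intro group_hom.intro group_hom_axioms.intro homI)
    fix A B :: "'k mat" assume "A \<in> carrier (GL n)" "B \<in> carrier (GL n)"
    then show "map_mat \<iota> (A \<otimes>\<^bsub>GL n\<^esub> B) = map_mat \<iota> A \<otimes>\<^bsub>GL n\<^esub> map_mat \<iota> B"
      by (auto simp: mult_GL carrier_GL hom.mat_hom_mult)
  qed (auto simp: group_GL carrier_GL)
  then have H: "subgroup ?H (GL n)" using group_hom.subgroup_img_is_subgroup subgroup_RC by blast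
  have T: "taylor_mat \<in> carrier (GL n)" using det_taylor_mat by (simp add: carrier_GL)
  note inv = inv_GL[OF T]
  have conj: "taylor_mat * (circ n (map_poly \<iota> g) * inv\<^bsub>GL n\<^esub> taylor_mat) = toeplitz_blocks m (taylor_family g)"
    if "degree g < n" for g
  proof -
    let ?B = "toeplitz_blocks m (taylor_family g)"
    have B: "?B \<in> carrier_mat n n"
      unfolding n_eq by (rule toeplitz_blocks_carrier) (simp add: taylor_family_def)
    have I: "inv\<^bsub>GL n\<^esub> taylor_mat \<in> carrier_mat n n" using inv(3) by (simp add: carrier_GL)
    have "taylor_mat * (circ n (map_poly \<iota> g) * inv\<^bsub>GL n\<^esub> taylor_mat) =
        (taylor_mat * circ n (map_poly \<iota> g)) * inv\<^bsub>GL n\<^esub> taylor_mat"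
      using I by (simp add: assoc_mult_mat[of _ n n _ n _ n])
    also have "taylor_mat * circ n (map_poly \<iota> g) = ?B * taylor_mat"
      using taylor_mat_circ[of "map_poly \<iota> g"] that unfolding taylor_family_def[abs_def] by simp
    also have "?B * taylor_mat * inv\<^bsub>GL n\<^esub> taylor_mat = ?B"
      using B I inv(2) by (simp add: assoc_mult_mat[of _ n n _ n _ n])
    finally show ?thesis .
  qed
  have "?K = toeplitz_blocks m ` taylor_family ` {g. degree g < n \<and> admissible (taylor_family g)}"
  proof (intro equalityI subsetI)
    fix A assume "A \<in> ?K"
    then obtain v where v: "A = toeplitz_blocks m v" "admissible v" by blast
    then obtain g where g: "degree g < n" "\<And>x. x \<in> {1..m} \<Longrightarrow> v x = taylor_family g x"
      using admissible_imp_taylor_family by blast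
    have "A = toeplitz_blocks m (taylor_family g)"
      unfolding v(1) toeplitz_blocks_def using g(2)
      by (intro arg_cong[of _ _ diag_block_mat] map_cong) auto
    moreover have "admissible (taylor_family g)" using g admissible_cong[of v "taylor_family g"] v(2) by simp
    ultimately show "A \<in> toeplitz_blocks m ` taylor_family ` {g. degree g < n \<and> admissible (taylor_family g)}"
      using g(1) by blast
  qed blast
  also have "\<dots> = (\<lambda>A. taylor_mat * (A * inv\<^bsub>GL n\<^esub> taylor_mat)) ` ?H"
    unfolding carrier_RC_eq image_image using conj by (intro image_cong) (auto simp: map_mat_circ)
  also have "\<dots> = taylor_mat <#\<^bsub>GL n\<^esub> (?H #>\<^bsub>GL n\<^esub> inv\<^bsub>GL n\<^esub> taylor_mat)"
    by (auto simp: l_coset_def r_coset_def mult_GL)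
  finally have K: "?K = taylor_mat <#\<^bsub>GL n\<^esub> (?H #>\<^bsub>GL n\<^esub> inv\<^bsub>GL n\<^esub> taylor_mat)" .
  have "subgroup ?K (GL n)"
    unfolding K using G.subgroup_conjugation_is_surj2[OF T H]
      G.coset_assoc[OF T inv(3) subgroup.subset[OF H]] by simp
  then show ?thesis unfolding conjugate_subgroups_def using H K T by blast
qed

end

section \<open>Finite fields\<close>

lemma linear_power_dvd_unity:
  fixes z :: "'a::field"
  assumes "Factorial_Ring.prime CHAR('a)" "z ^ m = 1" "m > 0"
  shows "[:- z, 1:] ^ (CHAR('a) ^ r) dvd monom 1 (m * CHAR('a) ^ r) - 1"
proof -
  let ?N = "CHAR('a) ^ r"
  let ?f = "monom 1 m - 1 :: 'a poly"
  \<comment> \<open>Splitting \<open>x^m\<close> as \<open>?f + 1\<close> avoids the sign of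
    \<open>(-1)^N\<close>.\<close>
  have "(?f + 1) ^ ?N = ?f ^ ?N + 1 ^ ?N"
    using assms(1) by (intro freshmans_dream'[where n = r]) simp_all
  then have "monom 1 (m * ?N) - 1 = ?f ^ ?N" by (simp add: monom_power)
  moreover have "[:- z, 1:] dvd ?f" using assms(2) by (simp add: poly_eq_0_iff_dvd[symmetric] poly_monom)
  ultimately show ?thesis using dvd_power_same by metis
qed

lemma exists_circulant_frobenius:
  fixes \<iota> :: "'k::field \<Rightarrow> 'a::field"
  assumes p: "Factorial_Ring.prime p" "\<not> p dvd m" and t: "t > 0" and m: "m > 0"
    and k: "card (UNIV :: 'k set) = p ^ t" and hom: "field_hom \<iota>"
    and cs: "cycle_decomposition {1..m} (sigma p t m) cs"
    and roots: "card {z::'a. z ^ m = 1} = m"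
  shows "\<exists>Z. circulant_frobenius p t m cs (p ^ r) (m * p ^ r) Z \<iota>"
proof -
  interpret field_hom \<iota> by (rule hom)
  have char: "CHAR('a) = p" using CHAR_eq_if_card_UNIV[OF p(1) k] CHAR_eq by simp
  interpret frobenius_cycles p t m cs
    using p m cs by unfold_locales (auto simp: prime_imp_coprime)
  obtain w :: 'a where "\<And>e. w ^ e = 1 \<longleftrightarrow> m dvd e"
    using exists_primitive_root_of_unity[OF m roots] by blast
  then obtain Z :: "nat \<Rightarrow> 'a" where Z: "inj_on Z {1..m}"
    "\<And>x. x \<in> {1..m} \<Longrightarrow> Z x ^ m = 1 \<and> Z (sigma p t m x) = Z x ^ (p ^ t)"
    using exists_root_labelling by blast
  have "circulant_frobenius p t m cs (p ^ r) (m * p ^ r) Z \<iota>"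
  proof unfold_locales
    show "[:- Z i, 1:] ^ (p ^ r) dvd monom 1 (m * p ^ r) - 1" if "i \<in> {1..m}" for i
      using linear_power_dvd_unity[of "Z i" m r] p(1) Z(2)[OF that] m unfolding char by simp
  qed (use p m t k Z prime_gt_0_nat in auto)
  then show ?thesis by blast
qed

lemma subfield_frobenius_fixed:
  assumes "Factorial_Ring.prime CHAR('a::field)" "Q = CHAR('a) ^ u"
  shows "subfield {x::'a. x ^ Q = x} ring_of_type_algebra"
proof -
  let ?R = "ring_of_type_algebra :: 'a ring"
  interpret R: Ring.field ?R by (rule field_from_type_algebra)
  interpret F: field_hom "\<lambda>x::'a. x ^ Q" using assms by (rule frobenius_field_hom)
  have ops: "x \<otimes>\<^bsub>?R\<^esub> y = x * y" "x \<oplus>\<^bsub>?R\<^esub> y = x + y" "\<one>\<^bsub>?R\<^esub> = 1" "\<zero>\<^bsub>?R\<^esub> = 0" "carrier ?R = UNIV" for x y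
    by (simp_all add: ring_of_type_algebra_def)
  have minus: "\<ominus>\<^bsub>?R\<^esub> x = - x" for x by (rule R.minus_equality) (simp_all add: ops)
  have inv: "inv\<^bsub>?R\<^esub> x = inverse x" if "x \<noteq> 0" for x
    by (rule R.comm_inv_char) (use that in \<open>simp_all add: ops\<close>)
  show ?thesis
  proof (rule R.subfieldI'[OF R.subringI])
    fix x assume "x \<in> {x. x ^ Q = x} - {\<zero>\<^bsub>?R\<^esub>}"
    then show "inv\<^bsub>?R\<^esub> x \<in> {x. x ^ Q = x}" by (simp add: ops inv power_inverse)
  qed (use F.hom_uminus F.hom_add in \<open>simp_all add: ops minus power_mult_distrib\<close>)
qed

text \<open>Each element of a subfield with \<open>Q\<close> elements solves \<open>x^Q = x\<close>;
  equal cardinality leaves only one such subfield.\<close>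

lemma subfield_of_order_eq:
  assumes "Factorial_Ring.prime CHAR('a::field)" "Q = CHAR('a) ^ u" and Q: "card {x::'a. x ^ Q = x} = Q"
    and fin: "finite {x::'a. x ^ Q = x}"
  shows "subfield_of_order Q = {x::'a. x ^ Q = x}"
  unfolding subfield_of_order_def
proof (rule the_equality)
  show "subfield {x::'a. x ^ Q = x} ring_of_type_algebra \<and> card {x::'a. x ^ Q = x} = Q"
    using subfield_frobenius_fixed[OF assms(1,2)] Q by simp
next
  fix L :: "'a set"
  assume L: "subfield L ring_of_type_algebra \<and> card L = Q"
  have "Q > 0" using assms(1,2) prime_gt_0_nat by simp
  then have finL: "finite L" using L by (metis card_ge_0_finite)
  interpret R: Ring.field "ring_of_type_algebra :: 'a ring" by (rule field_from_type_algebra)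
  have sub: "subring L ring_of_type_algebra" using L subfieldE(1) by blast
  have "0 \<in> L" using subringE(2)[OF sub] by (simp add: ring_of_type_algebra_def)
  moreover have "x * y \<in> L" if "x \<in> L" "y \<in> L" for x y
    using subringE(6)[OF sub that] by (simp add: ring_of_type_algebra_def)
  ultimately have "L \<subseteq> {x. x ^ Q = x}" using power_card_eq_self[OF finL] L by blast
  then show "L = {x. x ^ Q = x}" using L Q fin by (metis card_subset_eq)
qed

lemma field_hom_to_ac: "field_hom (to_ac :: 'k::field \<Rightarrow> 'k alg_closure)"
  by unfold_locales simp_all

lemma card_roots_of_unity_alg_closure:
  assumes "\<not> CHAR('k::field) dvd m"
  shows "card {z::'k alg_closure. z ^ m = 1} = m"
  using assms by (intro card_roots_of_unity_alg_closed) (simp add: of_nat_eq_0_iff_char_dvd)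

lemma card_frobenius_fixed_alg_closure:
  assumes "Factorial_Ring.prime CHAR('k::field)" "u > 0"
  shows "card {x::'k alg_closure. x ^ (CHAR('k) ^ u) = x} = CHAR('k) ^ u"
proof (rule card_frobenius_fixed_alg_closed)
  show "of_nat (CHAR('k) ^ u) = (0::'k alg_closure)"
    using assms(2) by (subst of_nat_eq_0_iff_char_dvd) simp
  show "CHAR('k) ^ u > 1" using prime_gt_1_nat[OF assms(1)] assms(2) by (rule one_less_power)
qed

lemma order_RC:
  assumes p: "Factorial_Ring.prime p" "\<not> p dvd m" and t: "t > 0" and m: "m > 0"
    and k: "card (UNIV :: 'k::field set) = p ^ t"
  shows "Coset.order (RC (m * p ^ r) :: 'k mat monoid) =
    (\<Prod>d | d dvd m. (p ^ (t * Pocklington.ord d (p ^ t)) - 1) ^ (totient d div Pocklington.ord d (p ^ t))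
       * p ^ (t * (p ^ r - 1) * totient d))"
proof -
  have char: "CHAR('k) = p" using CHAR_eq_if_card_UNIV[OF p(1) k] .
  have cop: "coprime p m" using p by (simp add: prime_imp_coprime)
  obtain cs where cs: "cycle_decomposition {1..m} (sigma p t m) cs"
    using cycle_decomposition_exists[OF sigma_permutes[OF cop m]] by auto
  have "card {z::'k alg_closure. z ^ m = 1} = m"
    by (rule card_roots_of_unity_alg_closure) (use p(2) char in simp)
  from exists_circulant_frobenius[OF p t m k field_hom_to_ac cs this]
  obtain Z where "circulant_frobenius p t m cs (p ^ r) (m * p ^ r) Z (to_ac :: 'k \<Rightarrow> 'k alg_closure)"
    by blast
  then interpret circulant_frobenius p t m cs "p ^ r" "m * p ^ r" Z "to_ac :: 'k \<Rightarrow> 'k alg_closure" .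
  let ?g = "\<lambda>L. (p ^ (t * L) - 1) * (p ^ (t * L)) ^ (p ^ r - 1)"
  have "Coset.order (RC (m * p ^ r) :: 'k mat monoid) = (\<Prod>c\<in>set cs. ?g (length c))"
    unfolding Coset.order_def
  proof (rule card_RC)
    fix c assume "c \<in> set cs"
    then have "t * length c > 0" using cycle_decomposition_length_pos[OF cs] t by simp
    then show "card {x::'k alg_closure. x ^ (p ^ (t * length c)) = x} = p ^ (t * length c)"
      using card_frobenius_fixed_alg_closure[where 'k = 'k, of "t * length c"] p(1) unfolding char by simp
  qed
  also have "\<dots> = (\<Prod>d | d dvd m. ?g (Pocklington.ord d (p ^ t)) ^ (totient d div Pocklington.ord d (p ^ t)))"
    by (rule prod_over_cycles)
  also have "\<dots> = (\<Prod>d | d dvd m. (p ^ (t * Pocklington.ord d (p ^ t)) - 1) ^ (totient d div Pocklington.ord d (p ^ t))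
       * p ^ (t * (p ^ r - 1) * totient d))"
  proof (rule prod.cong)
    fix d assume "d \<in> {d. d dvd m}"
    then have d: "d dvd m" by simp
    let ?o = "Pocklington.ord d (p ^ t)"
    \<comment> \<open>The order divides \<open>totient d\<close>, so the division in the exponent is
      exact.\<close>
    have tot: "totient d = ?o * (totient d div ?o)" using sum_length_cycles[OF d] by (metis dvd_mult_div_cancel dvd_triv_right)
    have "((p ^ (t * ?o)) ^ (p ^ r - 1)) ^ (totient d div ?o) =
        p ^ (t * (p ^ r - 1) * (?o * (totient d div ?o)))"
      by (simp only: power_mult[symmetric] mult_ac)
    then show "?g ?o ^ (totient d div ?o) =
        (p ^ (t * ?o) - 1) ^ (totient d div ?o) * p ^ (t * (p ^ r - 1) * totient d)"
      unfolding power_mult_distrib tot[symmetric] by simp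
  qed simp
  finally show ?thesis .
qed

section \<open>Degrees and subfields of a finite field\<close>

lemma range_to_ac_eq:
  assumes "card (UNIV :: 'a::field set) = CHAR('a) ^ s" "Factorial_Ring.prime CHAR('a)" "s > 0"
  shows "range (to_ac :: 'a \<Rightarrow> 'a alg_closure) = {y. y ^ (CHAR('a) ^ s) = y}"
proof -
  have pos: "card (UNIV :: 'a set) > 0" using assms prime_gt_0_nat by simp
  have fin: "finite (UNIV :: 'a set)" using pos by (rule card_ge_0_finite)
  have card: "card {y::'a alg_closure. y ^ (CHAR('a) ^ s) = y} = CHAR('a) ^ s"
    using card_frobenius_fixed_alg_closure assms by blast
  have "x ^ (CHAR('a) ^ s) = x" for x :: 'a
    using power_card_eq_self[OF fin, of x] assms(1) by simp
  then have "range (to_ac :: 'a \<Rightarrow> 'a alg_closure) \<subseteq> {y. y ^ (CHAR('a) ^ s) = y}"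
    by (auto simp flip: to_ac_power)
  moreover have "card (range (to_ac :: 'a \<Rightarrow> 'a alg_closure)) = CHAR('a) ^ s"
    by (subst card_image[OF inj_to_ac]) (rule assms(1))
  moreover have "finite {y::'a alg_closure. y ^ (CHAR('a) ^ s) = y}"
    by (rule card_ge_0_finite) (use card pos assms(1) in simp)
  ultimately show ?thesis using card by (intro card_subset_eq) simp_all
qed

lemma frobenius_fixed_power:
  fixes x :: "'a::comm_monoid_mult"
  assumes "x ^ (p ^ a) = x"
  shows "x ^ (p ^ (a * b)) = x"
proof (induction b)
  case (Suc b)
  have "x ^ (p ^ (a * Suc b)) = (x ^ (p ^ a)) ^ (p ^ (a * b))"
    by (simp add: power_add flip: power_mult)
  then show ?case using assms Suc by simp
qed simp

text \<open>The algebraic closure contains all the solutions; as \<open>u\<close> divides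
  \<open>s\<close>, they are also fixed by the \<open>p^s\<close> power map, where \<open>p\<close>
  is the characteristic, and therefore come from \<open>'a\<close>.\<close>

lemma card_frobenius_fixed_finite:
  assumes card: "card (UNIV :: 'a::field set) = CHAR('a) ^ s" and p: "Factorial_Ring.prime CHAR('a)"
    and u: "u dvd s" "s > 0"
  shows "card {x::'a. x ^ (CHAR('a) ^ u) = x} = CHAR('a) ^ u"
proof -
  let ?p = "CHAR('a)"
  have u0: "u > 0" using u by (auto intro: Nat.gr0I)
  obtain b where b: "s = u * b" using u(1) by (elim dvdE)
  have "to_ac ` {x::'a. x ^ (?p ^ u) = x} = {y::'a alg_closure. y ^ (?p ^ u) = y}"
  proof (intro equalityI subsetI)
    fix y :: "'a alg_closure" assume y: "y \<in> {y. y ^ (?p ^ u) = y}"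
    then have "y \<in> range to_ac"
      unfolding range_to_ac_eq[OF card p u(2)] b by (simp add: frobenius_fixed_power)
    then show "y \<in> to_ac ` {x. x ^ (?p ^ u) = x}" using y by (auto simp flip: to_ac_power)
  qed (auto simp flip: to_ac_power)
  moreover have "card (to_ac ` {x::'a. x ^ (?p ^ u) = x}) = card {x::'a. x ^ (?p ^ u) = x}"
    by (rule card_image[OF inj_on_subset[OF inj_to_ac subset_UNIV]])
  ultimately show ?thesis using card_frobenius_fixed_alg_closure[OF p u0] by simp
qed

text \<open>For \<open>e = s mod t > 0\<close>, the \<open>p^t\<close> elements of the image would
  all solve \<open>x^(p^e) = x\<close>, which has at most \<open>p^e < p^t\<close>
  solutions.\<close>

lemma degree_dvd_if_embeds:
  fixes \<iota> :: "'k::field \<Rightarrow> 'a::field"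
  assumes p: "Factorial_Ring.prime p" and t: "t > 0" and k: "card (UNIV :: 'k set) = p ^ t"
    and a: "card (UNIV :: 'a set) = p ^ s" and hom: "field_hom \<iota>"
  shows "t dvd s"
proof (rule ccontr)
  assume "\<not> t dvd s"
  then have u: "s mod t > 0" by (simp add: mod_greater_zero_iff_not_dvd)
  interpret field_hom \<iota> by (rule hom)
  have pos: "p > 0" using prime_gt_0_nat[OF p] .
  have fin: "finite (UNIV :: 'k set)" "finite (UNIV :: 'a set)"
    using k a pos by (auto intro!: card_ge_0_finite)
  have "\<iota> y ^ (p ^ (s mod t)) = \<iota> y" for y
  proof -
    have "\<iota> y ^ (p ^ t) = \<iota> y" using power_card_eq_self[OF fin(1), of y] k by (metis UNIV_I hom_power)
    then have "\<iota> y ^ (p ^ (t * (s div t))) = \<iota> y" by (rule frobenius_fixed_power)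
    then have "\<iota> y ^ (p ^ (s mod t)) = (\<iota> y ^ (p ^ (t * (s div t)))) ^ (p ^ (s mod t))" by simp
    also have "\<dots> = \<iota> y ^ (p ^ s)" by (simp flip: power_mult power_add)
    also have "\<dots> = \<iota> y" using power_card_eq_self[OF fin(2), of "\<iota> y"] a by simp
    finally show ?thesis .
  qed
  then have "range \<iota> \<subseteq> {x. x ^ (p ^ (s mod t)) = x}" by auto
  moreover have gt: "p ^ (s mod t) > 1" using prime_gt_1_nat[OF p] u by (rule one_less_power)
  ultimately have "card (range \<iota>) \<le> p ^ (s mod t)"
    using card_frobenius_fixed_le[OF gt, where 'a = 'a] card_mono by (metis le_trans)
  moreover have "card (range \<iota>) = p ^ t" using injectivity k by (simp add: card_image inj_def)
  moreover have "p ^ (s mod t) < p ^ t"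
    using prime_gt_1_nat[OF p] t by (intro power_strict_increasing) auto
  ultimately show False by simp
qed

text \<open>The order \<open>m\<close> of \<open>w\<close> divides \<open>(p^t)^k - 1\<close>, so
  \<open>k\<close> steps of \<open>sigma\<close> return to the start of any cycle.\<close>

lemma cycle_length_dvd_degree:
  fixes w :: "'a::field"
  assumes "frobenius_cycles p t m cs" "c \<in> set cs"
    and w: "\<And>e. w ^ e = 1 \<longleftrightarrow> m dvd e" and p: "p > 0"
    and a: "card (UNIV :: 'a set) = p ^ (t * k)"
  shows "length c dvd k"
proof -
  interpret frobenius_cycles p t m cs by fact
  have w0: "w \<noteq> 0" using w[of m] m_pos by (auto simp: power_0_left)
  have "finite (UNIV :: 'a set)" using a p by (auto intro!: card_ge_0_finite)
  then have "w * w ^ (p ^ (t * k) - 1) = w * 1"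
    using power_card_eq_self[of UNIV w] a p by (simp flip: power_Suc)
  then have "w ^ (p ^ (t * k) - 1) = 1" using w0 by simp
  then have "m dvd (p ^ t) ^ k - 1" using w by (simp add: power_mult)
  then have "[(p ^ t) ^ k = 1] (mod m)" using p by (simp add: cong_altdef_nat)
  then have "[(p ^ t) ^ k * c ! 0 = 1 * c ! 0] (mod m)" by (rule cong_scalar_right)
  then show ?thesis using length_cycle_dvd[OF assms(2)] by simp
qed

text \<open>The roots of unity act twice: they provide the labelling \<open>Z\<close>, and they
  force \<open>t * length c\<close> to divide \<open>s\<close>, so that the subfields in
  \<open>block_matrices\<close> exist and are Frobenius fixed sets.\<close>

lemma conjugate_RC_block_matrices:
  fixes \<iota> :: "'k::field \<Rightarrow> 'a::field"
  assumes p: "Factorial_Ring.prime p" "\<not> p dvd m" and t: "t > 0" and m: "m > 0"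
    and k: "card (UNIV :: 'k set) = p ^ t" and a: "card (UNIV :: 'a set) = p ^ s"
    and hom: "field_hom \<iota>" and roots: "contains_roots_of_unity TYPE('a) m"
    and cs: "cycle_decomposition {1..m} (sigma p t m) cs"
  shows "conjugate_subgroups (GL (m * p ^ r)) (map_mat \<iota> ` carrier (RC (m * p ^ r) :: 'k mat monoid))
    (block_matrices p t m r cs)"
proof -
  have char: "CHAR('a) = p" using CHAR_eq_if_card_UNIV[OF p(1) a] .
  have pos: "p > 0" using prime_gt_0_nat[OF p(1)] .
  have "to_ac ` {z::'a. z ^ m = 1} = {z::'a alg_closure. z ^ m = 1}"
    using roots unfolding contains_roots_of_unity_def by (auto simp flip: to_ac_power)
  moreover have "card (to_ac ` {z::'a. z ^ m = 1}) = card {z::'a. z ^ m = 1}"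
    by (rule card_image[OF inj_on_subset[OF inj_to_ac subset_UNIV]])
  ultimately have c: "card {z::'a. z ^ m = 1} = m"
    using card_roots_of_unity_alg_closure[where 'k = 'a, of m] p(2) char by simp
  obtain Z where "circulant_frobenius p t m cs (p ^ r) (m * p ^ r) Z \<iota>"
    using exists_circulant_frobenius[OF p t m k hom cs c] by blast
  then interpret circulant_frobenius p t m cs "p ^ r" "m * p ^ r" Z \<iota> .
  obtain w :: 'a where w: "\<And>e. w ^ e = 1 \<longleftrightarrow> m dvd e"
    using exists_primitive_root_of_unity[OF m c] by blast
  obtain b where b: "s = t * b" using degree_dvd_if_embeds[OF p(1) t k a hom] by (elim dvdE)
  have s: "s > 0"
  proof (rule ccontr)
    assume "\<not> s > 0"
    then have "card (UNIV :: 'a set) = 1" using a by simp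
    then show False by (metis card_1_singletonE UNIV_I singletonD zero_neq_one)
  qed
  have sub: "subfield_of_order (p ^ (t * length c)) = {x::'a. x ^ (p ^ (t * length c)) = x}"
    if "c \<in> set cs" for c
  proof -
    have "length c dvd b"
      using cycle_length_dvd_degree[OF frobenius_cycles_axioms that w pos] a b by simp
    then have dv: "t * length c dvd s" unfolding b by simp
    have 1: "card {x::'a. x ^ (p ^ (t * length c)) = x} = p ^ (t * length c)"
      using card_frobenius_fixed_finite[where 'a = 'a, of s "t * length c"] a p(1) dv s unfolding char by simp
    have 2: "finite {x::'a. x ^ (p ^ (t * length c)) = x}" using 1 pos by (metis card_ge_0_finite zero_less_power)
    show ?thesis
      by (rule subfield_of_order_eq[OF _ _ 1 2]) (use p(1) in \<open>simp_all add: char\<close>)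
  qed
  have eq: "(\<forall>c\<in>set cs. set\<^sub>v (v (c ! 0)) \<subseteq> subfield_of_order (p ^ (t * length c)) \<and>
        (\<forall>i\<in>{1..<length c}. v (c ! i) = frob p (i * t) (v (c ! 0)))) \<longleftrightarrow>
      (\<forall>c\<in>set cs. set\<^sub>v (v (c ! 0)) \<subseteq> {x. x ^ (p ^ (t * length c)) = x} \<and>
        (\<forall>i\<in>{1..<length c}. v (c ! i) = frob p (i * t) (v (c ! 0))))" for v :: "nat \<Rightarrow> 'a vec"
    by (intro ball_cong refl) (simp only: sub)
  have "block_matrices p t m r cs = {toeplitz_blocks m v | v. admissible v}"
    unfolding block_matrices_def toeplitz_blocks_def admissible_iff_cycles eq ..
  then show ?thesis using conjugate_toeplitz_blocks by simp
qed

theorem theorem1p1: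
  fixes p t m r n :: nat
  assumes "Factorial_Ring.prime p" and "t \<ge> 1" and "m \<ge> 1" and "\<not> p dvd m"
    and "n = m * p ^ r"
    and "card (UNIV :: 'k::field set) = p ^ t"
  shows "Coset.order (RC n :: 'k mat monoid) =
           (\<Prod>d | d dvd m.
              (p ^ (t * Pocklington.ord d (p ^ t)) - 1) ^ (totient d div Pocklington.ord d (p ^ t))
              * p ^ (t * (p ^ r - 1) * totient d))
       \<and> (\<forall>(s :: nat) (\<iota> :: 'k \<Rightarrow> 'a::field) cs.
            card (UNIV :: 'a set) = p ^ s \<longrightarrow> field_hom \<iota> \<longrightarrow>
            contains_roots_of_unity TYPE('a) m \<longrightarrow>
            cycle_decomposition {1..m} (sigma p t m) cs \<longrightarrow>
            conjugate_subgroups (GL n)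
              (map_mat \<iota> ` carrier (RC n :: 'k mat monoid))
              (block_matrices p t m r cs :: 'a mat set))"
  unfolding \<open>n = m * p ^ r\<close>
proof (intro conjI allI impI)
  show "Coset.order (RC (m * p ^ r) :: 'k mat monoid) =
      (\<Prod>d | d dvd m.
        (p ^ (t * Pocklington.ord d (p ^ t)) - 1) ^ (totient d div Pocklington.ord d (p ^ t))
        * p ^ (t * (p ^ r - 1) * totient d))"
    by (rule order_RC) (use assms in simp_all)
next
  fix s and \<iota> :: "'k \<Rightarrow> 'a" and cs
  assume "card (UNIV :: 'a set) = p ^ s" "field_hom \<iota>" "contains_roots_of_unity TYPE('a) m"
    "cycle_decomposition {1..m} (sigma p t m) cs"
  then show "conjugate_subgroups (GL (m * p ^ r))
      (map_mat \<iota> ` carrier (RC (m * p ^ r) :: 'k mat monoid)) (block_matrices p t m r cs)"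
    by (intro conjugate_RC_block_matrices) (use assms in simp_all)
qed

end
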